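(* Let $d\in\mathbb{N}=\{1,2,3,\ldots\}$. The following statements are equivalent. (i) The class of quasi-infinitely divisible distributions on $\mathbb{R}^d$ is dense in the class of all distributions on $\mathbb{R}^d$ with respect to weak convergence. (ii) Every characteristic function on $\mathbb{R}^d$ (i.e. the characteristic function $\widehat{\mu}$ of any distribution $\mu$ on $\mathbb{R}^d$) can be written as the local uniform limit of zero-free continuous complex-valued functions on $\mathbb{R}^d$; that is, there is a sequence of continuous functions $f_n:\mathbb{R}^d\to\mathbb{C}$, each vanishing nowhere on $\mathbb{R}^d$, that converges to $\widehat{\mu}$ uniformly on every compact subset of $\mathbb{R}^d$. (iii) $d=1$.
   Context: A distribution on $\mathbb{R}^d$ is a Borel probability measure on $\mathbb{R}^d$. The characteristic function of a distribution $\mu$ on $\mathbb{R}^d$ is $\widehat{\mu}(t)=\int_{\mathbb{R}^d}e^{\mathrm{i}\langle t,z\rangle}\,\mu(\mathrm{d}z)$, $t\in\mathbb{R}^d$. A distribution $\mu$ on $\mathbb{R}^d$ is infinitely divisible if for every $n\in\mathbb{N}$ there is a distribution $\mu_n$ on $\mathbb{R}^d$ whose $n$-fold convolution with itself equals $\mu$ (it is standard that $\widehat{\mu}$ then has no zeros). A distribution $\mu$ on $\mathbb{R}^d$ is quasi-infinitely divisible if there exist infinitely divisible distributions $\mu_1,\mu_2$ on $\mathbb{R}^d$ such that $\widehat{\mu}(t)=\widehat{\mu_1}(t)/\widehat{\mu_2}(t)$ for all $t\in\mathbb{R}^d$. Denseness with respect to weak convergence means that every distribution on $\mathbb{R}^d$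 is the weak limit (convergence of integrals of all bounded continuous functions) of a sequence of quasi-infinitely divisible distributions on $\mathbb{R}^d$. *)

theory Defs
  imports "HOL-Probability.Probability"
begin

definition is_distribution :: "'a :: euclidean_space measure \<Rightarrow> bool" where
  "is_distribution \<mu> \<longleftrightarrow> prob_space \<mu> \<and> sets \<mu> = sets borel"

definition char_fun :: "'a :: euclidean_space measure \<Rightarrow> 'a \<Rightarrow> complex" where
  "char_fun \<mu> t = (CLINT z|\<mu>. iexp (t \<bullet> z))"

text \<open>The 0-fold convolution power is the unit mass at the origin, so for \<open>n \<ge> 1\<close> and a Borel
  probability measure \<open>\<mu>\<close> this is the convolution of \<open>n\<close> copies of \<open>\<mu>\<close>.\<close>

primrec convolution_power :: "'a :: ordered_euclidean_space measure \<Rightarrow> nat \<Rightarrow> 'a measure" where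
  "convolution_power \<mu> 0 = return borel 0"
| "convolution_power \<mu> (Suc n) = (\<mu> \<star> convolution_power \<mu> n)"

definition infinitely_divisible :: "'a :: ordered_euclidean_space measure \<Rightarrow> bool" where
  "infinitely_divisible \<mu> \<longleftrightarrow> is_distribution \<mu> \<and>
     (\<forall>n\<ge>1. \<exists>\<nu>. is_distribution \<nu> \<and> convolution_power \<nu> n = \<mu>)"

text \<open>The quotient is a genuine one, as the characteristic function of an infinitely divisible
  distribution has no zeros.\<close>

definition quasi_infinitely_divisible :: "'a :: ordered_euclidean_space measure \<Rightarrow> bool" where
  "quasi_infinitely_divisible \<mu> \<longleftrightarrow> is_distribution \<mu> \<and>
     (\<exists>\<mu>1 \<mu>2. infinitely_divisible \<mu>1 \<and> infinitely_divisible \<mu>2 \<and>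
        (\<forall>t. char_fun \<mu> t = char_fun \<mu>1 t / char_fun \<mu>2 t))"

text \<open>The constant \<^const>\<open>weak_conv_m\<close> is restricted to measures on the real line.\<close>

definition weakly_converges :: "(nat \<Rightarrow> 'a :: euclidean_space measure) \<Rightarrow> 'a measure \<Rightarrow> bool" where
  "weakly_converges \<nu> \<mu> \<longleftrightarrow>
     (\<forall>f :: 'a \<Rightarrow> real. continuous_on UNIV f \<longrightarrow> bounded (range f) \<longrightarrow>
        (\<lambda>n. LINT z|\<nu> n. f z) \<longlonglongrightarrow> (LINT z|\<mu>. f z))"

lemma char_fun_real: "char_fun (\<mu> :: real measure) = char \<mu>"
  by (simp add: fun_eq_iff char_fun_def char_def)

lemma convolution_power_1:
  assumes "is_distribution \<mu>"
  shows "convolution_power \<mu> 1 = \<mu>"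
proof (rule measure_eqI)
  have sets_eq: "sets \<mu> = sets borel" and "prob_space \<mu>"
    using assms by (auto simp: is_distribution_def)
  show "sets (convolution_power \<mu> 1) = sets \<mu>"
    by (simp add: sets_eq)
  fix A assume "A \<in> sets (convolution_power \<mu> 1)"
  then have A: "A \<in> sets borel" by simp
  interpret prob_space \<mu> by fact
  interpret d: prob_space "return borel (0 :: 'a)" by (rule prob_space_return) simp
  show "emeasure (convolution_power \<mu> 1) A = emeasure \<mu> A"
    using A d.finite_measure_axioms finite_measure_axioms
    by (simp add: convolution_emeasure' sets_eq nn_integral_return nn_integral_indicator)
qed

end

theory Submission
  imports Defs "HOL-Computational_Algebra.Fundamental_Theorem_Algebra"
begin

text \<open>
  Weak convergence implies locally uniform convergence of characteristic functions, and the
  characteristic function of a quasi-infinitely divisible distribution has no zeros; hence denseness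
  implies zero-free approximability. In dimension at least 2 the characteristic function
  \<open>(1 + exp (\<i> t\<^sub>1) + exp (\<i> t\<^sub>2)) / 3\<close> has an isolated zero that, by Brouwer's fixed point theorem, every
  sufficiently close continuous function inherits. In dimension 1 every distribution is a weak limit of
  distributions on finite parts of lattices, whose characteristic functions are polynomials \<open>P\<close> in
  \<open>exp (\<i> \<theta>)\<close>. After a small exponential tilt \<open>P\<close> has no zeros on the unit circle, and factoring it into
  linear factors exhibits it as a quotient of shifted compound Poisson characteristic functions.
\<close>

section \<open>Characteristic functions on Euclidean spaces\<close>

text \<open>For |u| < 1 the factor 1 - u z has the logarithm - \<Sum> u^n z^n / n. A series with
  real, absolutely summable coefficients exponentiates to a quotient of infinitely divisible
  characteristic functions (up to a constant): its positive and negative parts each become the Levy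
  weights of a compound Poisson law. A root on the unit circle would destroy the summability, so the
  tilt has to come first, and finite support leaves only finitely many roots to avoid. Complex roots
  give complex coefficients, so only the square of the polynomial is represented directly; the sign
  lost in the square root is recovered from continuity on the connected real line and the value 1 at
  the origin.

  The dimension enters through the zeros. At (2\<pi>/3, 4\<pi>/3) the two partial derivatives of 1 +
  exp(i t1) + exp(i t2) are linearly independent over the reals, so the values cover a disc around 0
  and a small perturbation cannot avoid 0. When d > 2, restricting to a plane spanned by two basis
  vectors is enough.\<close>

lemma is_distributionD:
  assumes "is_distribution \<mu>"
  shows "prob_space \<mu>" "sets \<mu> = sets borel" "space \<mu> = UNIV" "finite_measure \<mu>"
  using assms sets_eq_imp_space_eq[of \<mu> borel]
  by (auto simp: is_distribution_def prob_space.finite_measure)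

lemma borel_measurable_is_distribution:
  assumes "is_distribution \<mu>" "f \<in> borel_measurable borel"
  shows "f \<in> borel_measurable \<mu>"
  using assms by (simp add: is_distribution_def cong: measurable_cong_sets)

lemma integrable_is_distribution_bounded:
  fixes f :: "'a::euclidean_space \<Rightarrow> 'b::{banach,second_countable_topology}"
  assumes "is_distribution \<mu>" "f \<in> borel_measurable borel" "\<And>z. norm (f z) \<le> B"
  shows "integrable \<mu> f"
proof -
  interpret prob_space \<mu> using assms(1) by (rule is_distributionD)
  show ?thesis
    using borel_measurable_is_distribution[OF assms(1,2)] assms(3)
    by (intro integrable_const_bound[of _ B]) auto
qed

lemma integrable_iexp_inner:
  assumes "is_distribution \<mu>"
  shows "integrable \<mu> (\<lambda>z. iexp (t \<bullet> z))"
  by (rule integrable_is_distribution_bounded[OF assms, where B = 1]) auto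

lemma is_distribution_distr:
  assumes "prob_space M" "f \<in> borel_measurable M"
  shows "is_distribution (distr M borel f)"
  using assms by (simp add: is_distribution_def prob_space.prob_space_distr)

lemma is_distribution_convolution:
  assumes "is_distribution \<mu>" "is_distribution \<nu>"
  shows "is_distribution (\<mu> \<star> \<nu>)"
proof -
  interpret \<mu>: prob_space \<mu> using assms(1) by (rule is_distributionD)
  interpret \<nu>: prob_space \<nu> using assms(2) by (rule is_distributionD)
  interpret pair_prob_space \<mu> \<nu> ..
  note [measurable_cong] = is_distributionD(2)[OF assms(1)] is_distributionD(2)[OF assms(2)]
  show ?thesis
    unfolding convolution_def by (rule is_distribution_distr) (auto intro: prob_space_axioms)
qed

lemma char_fun_convolution:
  assumes "is_distribution \<mu>" "is_distribution \<nu>"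
  shows "char_fun (\<mu> \<star> \<nu>) t = char_fun \<mu> t * char_fun \<nu> t"
proof -
  interpret \<mu>: prob_space \<mu> using assms(1) by (rule is_distributionD)
  interpret \<nu>: prob_space \<nu> using assms(2) by (rule is_distributionD)
  interpret pair_prob_space \<mu> \<nu> ..
  note [measurable_cong] = is_distributionD(2)[OF assms(1)] is_distributionD(2)[OF assms(2)]
  have "char_fun (\<mu> \<star> \<nu>) t = (CLINT z|\<mu> \<Otimes>\<^sub>M \<nu>. iexp (t \<bullet> (fst z + snd z)))"
    unfolding char_fun_def convolution_def by (subst integral_distr) (auto simp: case_prod_beta)
  also have "\<dots> = (CLINT z|\<mu> \<Otimes>\<^sub>M \<nu>. (case z of (x, y) \<Rightarrow> iexp (t \<bullet> x) * iexp (t \<bullet> y)))"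
    by (simp add: case_prod_beta inner_add_right exp_add distrib_left)
  also have "\<dots> = (CLINT x|\<mu>. CLINT y|\<nu>. iexp (t \<bullet> x) * iexp (t \<bullet> y))"
  proof -
    have "integrable (\<mu> \<Otimes>\<^sub>M \<nu>) (\<lambda>(x, y). iexp (t \<bullet> x) * iexp (t \<bullet> y))"
      by (rule integrable_const_bound[of _ 1]) (auto simp: case_prod_beta norm_mult)
    from integral_fst'[OF this] show ?thesis by simp
  qed
  finally show ?thesis
    by (simp add: char_fun_def)
qed

lemma char_fun_distr_uminus:
  assumes "is_distribution \<mu>"
  shows "char_fun (distr \<mu> borel uminus) t = cnj (char_fun \<mu> t)"
proof -
  note [measurable_cong] = is_distributionD(2)[OF assms]
  have "char_fun (distr \<mu> borel uminus) t = (CLINT z|\<mu>. cnj (iexp (t \<bullet> z)))"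
    unfolding char_fun_def by (subst integral_distr) (auto simp: exp_cnj simp del: Bochner_Integration.integral_cnj)
  also have "\<dots> = cnj (char_fun \<mu> t)"
    unfolding char_fun_def by (rule Bochner_Integration.integral_cnj)
  finally show ?thesis .
qed

lemma char_fun_0:
  assumes "is_distribution \<mu>"
  shows "char_fun \<mu> 0 = 1"
  using prob_space.prob_space[OF is_distributionD(1)[OF assms]] by (simp add: char_fun_def)

lemma norm_iexp_diff_le: "norm (iexp x - iexp y) \<le> min 2 \<bar>x - y\<bar>"
proof -
  have "iexp x - iexp y = iexp y * (iexp (x - y) - 1)"
    by (simp add: algebra_simps flip: exp_add)
  then have "norm (iexp x - iexp y) = norm (iexp (x - y) - 1)"
    by (simp add: norm_mult)
  also have "\<dots> \<le> min 2 \<bar>x - y\<bar>"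
    using iexp_approx1[of "x - y" 0] norm_triangle_ineq4[of "iexp (x - y)" 1] by simp
  finally show ?thesis .
qed

text \<open>The cutoff at 2 makes this modulus of continuity finite without any moment assumption.
  It depends on \<mu> only through the integral of one bounded continuous function, so weak
  convergence controls it along a whole sequence.\<close>

lemma norm_char_fun_diff_le:
  assumes "is_distribution \<mu>" "norm (s - t) \<le> \<delta>"
  shows "norm (char_fun \<mu> s - char_fun \<mu> t) \<le> (LINT z|\<mu>. min 2 (\<delta> * norm z))"
proof -
  have "0 \<le> \<delta>" using assms(2) norm_ge_zero order_trans by blast
  have "norm (char_fun \<mu> s - char_fun \<mu> t) = norm (CLINT z|\<mu>. iexp (s \<bullet> z) - iexp (t \<bullet> z))"
    by (simp add: char_fun_def integrable_iexp_inner[OF assms(1)])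
  also have "\<dots> \<le> (LINT z|\<mu>. norm (iexp (s \<bullet> z) - iexp (t \<bullet> z)))"
    by (rule integral_norm_bound)
  also have "\<dots> \<le> (LINT z|\<mu>. min 2 (\<delta> * norm z))"
  proof (rule integral_mono)
    show "integrable \<mu> (\<lambda>z. norm (iexp (s \<bullet> z) - iexp (t \<bullet> z)))"
      by (intro integrable_norm Bochner_Integration.integrable_diff integrable_iexp_inner assms(1))
    show "integrable \<mu> (\<lambda>z. min 2 (\<delta> * norm z))"
      by (rule integrable_is_distribution_bounded[OF assms(1), where B = 2]) (use \<open>0 \<le> \<delta>\<close> in auto)
    fix z
    have "\<bar>s \<bullet> z - t \<bullet> z\<bar> \<le> norm (s - t) * norm z"
      by (metis Cauchy_Schwarz_ineq2 inner_diff_left)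
    also have "\<dots> \<le> \<delta> * norm z" using assms(2) by (intro mult_right_mono) auto
    finally show "norm (iexp (s \<bullet> z) - iexp (t \<bullet> z)) \<le> min 2 (\<delta> * norm z)"
      using norm_iexp_diff_le[of "s \<bullet> z" "t \<bullet> z"] by linarith
  qed
  finally show ?thesis .
qed

lemma tendsto_integral_min_norm:
  assumes "is_distribution \<mu>"
  shows "(\<lambda>n. LINT z|\<mu>. min 2 (inverse (real (Suc n)) * norm z)) \<longlonglongrightarrow> 0"
proof -
  have "(\<lambda>n. LINT z|\<mu>. min 2 (inverse (real (Suc n)) * norm z)) \<longlonglongrightarrow> (LINT z|\<mu>. 0)"
  proof (rule integral_dominated_convergence[where w = "\<lambda>_. 2"])
    show "integrable \<mu> (\<lambda>_. 2 :: real)"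
      by (rule integrable_is_distribution_bounded[OF assms, where B = 2]) auto
    show "AE z :: 'a in \<mu>. (\<lambda>n. min 2 (inverse (real (Suc n)) * norm z)) \<longlonglongrightarrow> 0"
    proof (rule AE_I2)
      fix z :: 'a
      have "(\<lambda>n. min 2 (inverse (real (Suc n)) * norm z)) \<longlonglongrightarrow> min 2 (0 * norm z)"
        by (intro tendsto_intros LIMSEQ_inverse_real_of_nat)
      then show "(\<lambda>n. min 2 (inverse (real (Suc n)) * norm z)) \<longlonglongrightarrow> 0" by simp
    qed
  qed (auto intro!: borel_measurable_is_distribution[OF assms])
  then show ?thesis by simp
qed

lemma continuous_on_char_fun:
  assumes "is_distribution \<mu>"
  shows "continuous_on A (char_fun \<mu>)"
proof (rule uniformly_continuous_imp_continuous)
  show "uniformly_continuous_on A (char_fun \<mu>)"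
    unfolding uniformly_continuous_on_def
  proof (intro allI impI)
    fix e :: real assume "e > 0"
    then obtain n where n: "(LINT z|\<mu>. min 2 (inverse (real (Suc n)) * norm z)) < e"
      using order_tendstoD(2)[OF tendsto_integral_min_norm[OF assms]]
      by (blast dest: eventually_happens'[OF sequentially_bot])
    show "\<exists>d>0. \<forall>x\<in>A. \<forall>x'\<in>A. dist x' x < d \<longrightarrow> dist (char_fun \<mu> x') (char_fun \<mu> x) < e"
    proof (intro exI[of _ "inverse (real (Suc n))"] conjI ballI impI)
      fix x x' :: 'a assume "dist x' x < inverse (real (Suc n))"
      then have "norm (x' - x) \<le> inverse (real (Suc n))" by (simp add: dist_norm)
      from norm_char_fun_diff_le[OF assms this] n
      show "dist (char_fun \<mu> x') (char_fun \<mu> x) < e" by (simp add: dist_norm)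
    qed simp
  qed
qed

text \<open>Pointwise convergence becomes uniform on K by equicontinuity: the modulus bounding the
  limit also bounds almost all members of the sequence, and a finite \<delta>-net of K reduces the
  claim to finitely many points.\<close>

lemma weakly_converges_imp_uniform_limit_char_fun:
  assumes \<nu>: "\<And>n. is_distribution (\<nu> n)" and \<mu>: "is_distribution \<mu>"
    and conv: "weakly_converges \<nu> \<mu>" and "compact K"
  shows "uniform_limit K (\<lambda>n. char_fun (\<nu> n)) (char_fun \<mu>) sequentially"
proof (rule uniform_limitI)
  fix e :: real assume "e > 0"
  then have e4: "e / 4 > 0" by simp
  have integral_conv: "(\<lambda>n. LINT z|\<nu> n. f z) \<longlonglongrightarrow> (LINT z|\<mu>. f z)"
    if "continuous_on UNIV f" "\<And>z. \<bar>f z\<bar> \<le> 2" for f :: "'a \<Rightarrow> real"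
    using conv that unfolding weakly_converges_def bounded_iff by auto
  \<comment> \<open>A quarter of \<open>e\<close> is spent on each of three differences: from t to a
    net point for \<open>\<nu> n\<close>, from \<open>\<nu> n\<close> to \<mu> at the net point, and
    back to t for \<mu>.\<close>
  obtain m where m: "(LINT z|\<mu>. min 2 (inverse (real (Suc m)) * norm z)) < e / 4"
    using order_tendstoD(2)[OF tendsto_integral_min_norm[OF \<mu>] e4]
    by (blast dest: eventually_happens'[OF sequentially_bot])
  define \<delta> where "\<delta> = inverse (real (Suc m))"
  have \<delta>: "\<delta> > 0" by (simp add: \<delta>_def)
  let ?h = "\<lambda>z :: 'a. min 2 (\<delta> * norm z)"
  have "(\<lambda>n. LINT z|\<nu> n. ?h z) \<longlonglongrightarrow> (LINT z|\<mu>. ?h z)"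
    using \<delta> by (intro integral_conv continuous_intros) auto
  then have equi: "\<forall>\<^sub>F n in sequentially. (LINT z|\<nu> n. ?h z) < e / 4"
    by (rule order_tendstoD(2)) (use m in \<open>simp add: \<delta>_def\<close>)
  obtain F where F: "finite F" "F \<subseteq> K" "K \<subseteq> (\<Union>x\<in>F. ball x \<delta>)"
  proof (rule compactE_image[OF \<open>compact K\<close>, of K "\<lambda>x. ball x \<delta>"])
    show "K \<subseteq> (\<Union>x\<in>K. ball x \<delta>)" using \<delta> by force
  qed auto
  have pointwise: "(\<lambda>n. char_fun (\<nu> n) t) \<longlonglongrightarrow> char_fun \<mu> t" for t
  proof -
    \<comment> \<open>Weak convergence is tested against real functions only, hence the split into
      cosine and sine.\<close>
    have "(\<lambda>n. Complex (LINT z|\<nu> n. cos (t \<bullet> z)) (LINT z|\<nu> n. sin (t \<bullet> z)))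
        \<longlonglongrightarrow> Complex (LINT z|\<mu>. cos (t \<bullet> z)) (LINT z|\<mu>. sin (t \<bullet> z))"
      by (intro tendsto_Complex integral_conv continuous_intros)
         (auto intro: order_trans[OF abs_cos_le_one] order_trans[OF abs_sin_le_one])
    moreover have "char_fun M t = Complex (LINT z|M. cos (t \<bullet> z)) (LINT z|M. sin (t \<bullet> z))"
      if "is_distribution M" for M :: "'a measure"
      using integrable_iexp_inner[OF that, of t]
      by (intro complex_eqI) (simp_all add: char_fun_def Re_exp Im_exp flip: integral_Re integral_Im)
    ultimately show ?thesis by (simp add: \<nu> \<mu>)
  qed
  have "\<forall>\<^sub>F n in sequentially. \<forall>x\<in>F. dist (char_fun (\<nu> n) x) (char_fun \<mu> x) < e / 4"
    using F(1) tendstoD[OF pointwise e4] by (simp add: eventually_ball_finite)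
  with equi show "\<forall>\<^sub>F n in sequentially. \<forall>t\<in>K. dist (char_fun (\<nu> n) t) (char_fun \<mu> t) < e"
  proof eventually_elim
    case (elim n)
    show ?case
    proof
      fix t assume "t \<in> K"
      then obtain x where x: "x \<in> F" "norm (x - t) < \<delta>"
        using F(3) by (auto simp: dist_norm)
      then have "norm (t - x) \<le> \<delta>" by (simp add: norm_minus_commute)
      have "norm (char_fun (\<nu> n) t - char_fun (\<nu> n) x) < e / 4"
        using norm_char_fun_diff_le[OF \<nu>[of n] \<open>norm (t - x) \<le> \<delta>\<close>] elim(1) by linarith
      moreover have "norm (char_fun \<mu> x - char_fun \<mu> t) < e / 4"
        using norm_char_fun_diff_le[OF \<mu>, of x t \<delta>] x m by (simp add: \<delta>_def)
      moreover have "norm (char_fun (\<nu> n) x - char_fun \<mu> x) < e / 4"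
        using elim(2) x by (simp add: dist_norm)
      moreover note dist_triangle[of "char_fun (\<nu> n) t" "char_fun \<mu> t" "char_fun (\<nu> n) x"]
        dist_triangle[of "char_fun (\<nu> n) x" "char_fun \<mu> t" "char_fun \<mu> x"]
      ultimately show "dist (char_fun (\<nu> n) t) (char_fun \<mu> t) < e"
        using \<open>e > 0\<close> by (simp add: dist_norm)
    qed
  qed
qed

section \<open>Zero-freeness of infinitely divisible characteristic functions\<close>

lemma one_minus_Re_char_fun_double:
  assumes "is_distribution \<mu>"
  shows "1 - Re (char_fun \<mu> (2 *\<^sub>R t)) \<le> 4 * (1 - Re (char_fun \<mu> t))"
proof -
  interpret prob_space \<mu> using assms by (rule is_distributionD)
  have int: "integrable \<mu> (\<lambda>z. cos (s \<bullet> z))" for s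
    by (rule integrable_is_distribution_bounded[OF assms, where B = 1]) auto
  have Re: "1 - Re (char_fun \<mu> s) = (LINT z|\<mu>. 1 - cos (s \<bullet> z))" for s
    using integrable_iexp_inner[OF assms, of s] int[of s]
    by (simp add: char_fun_def Re_exp prob_space flip: integral_Re)
  \<comment> \<open>The difference of the two sides is 2 (1 - cos x)^2.\<close>
  have "1 - cos (2 * x) \<le> 4 * (1 - cos x)" for x :: real
  proof -
    have "0 \<le> (1 - cos x)\<^sup>2" by simp
    moreover have "cos (2 * x) = 2 * (cos x)\<^sup>2 - 1" by (rule cos_double_cos)
    ultimately show ?thesis by (simp add: power2_diff)
  qed
  then have "(LINT z|\<mu>. 1 - cos ((2 *\<^sub>R t) \<bullet> z)) \<le> (LINT z|\<mu>. 4 * (1 - cos (t \<bullet> z)))"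
    by (intro integral_mono Bochner_Integration.integrable_diff integrable_mult_right int) auto
  then show ?thesis by (simp only: Re integral_mult_right_zero)
qed

text \<open>Symmetrisation: convolving \<mu> with its reflection gives a law whose characteristic
  function is real and equal to the squared modulus, so the inequality for real parts applies to
  it.\<close>

lemma one_minus_norm_char_fun_double:
  fixes \<mu> :: "'a::ordered_euclidean_space measure"
  assumes "is_distribution \<mu>"
  shows "1 - (norm (char_fun \<mu> (2 *\<^sub>R t)))\<^sup>2 \<le> 4 * (1 - (norm (char_fun \<mu> t))\<^sup>2)"
proof -
  have d: "is_distribution (distr \<mu> borel uminus)"
    by (rule is_distribution_distr[OF is_distributionD(1)[OF assms]
          borel_measurable_is_distribution[OF assms]])
       (intro borel_measurable_continuous_onI continuous_intros)
  have "char_fun (\<mu> \<star> distr \<mu> borel uminus) s = of_real ((norm (char_fun \<mu> s))\<^sup>2)" for s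
    unfolding char_fun_convolution[OF assms d] char_fun_distr_uminus[OF assms]
    by (rule complex_norm_square[symmetric])
  then show ?thesis
    using one_minus_Re_char_fun_double[OF is_distribution_convolution[OF assms d], of t]
    by (simp only: Re_complex_of_real)
qed

lemma is_distribution_convolution_power:
  assumes "is_distribution \<mu>"
  shows "is_distribution (convolution_power \<mu> n)"
proof (induction n)
  case 0
  show ?case by (simp add: is_distribution_def prob_space_return)
qed (simp add: is_distribution_convolution assms)

lemma char_fun_convolution_power:
  assumes "is_distribution \<mu>"
  shows "char_fun (convolution_power \<mu> n) t = char_fun \<mu> t ^ n"
proof (induction n)
  case 0
  show ?case
    unfolding char_fun_def convolution_power.simps by (subst integral_return) auto
next
  case (Suc n)
  then show ?case
    by (simp add: char_fun_convolution assms is_distribution_convolution_power)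
qed

text \<open>If the \<open>n\<close>-th root has a zero at \<open>2 t\<close>, the doubling inequality bounds it away from 1 at \<open>t\<close>,
  uniformly in \<open>n\<close>, so its \<open>n\<close>-th power is arbitrarily small there.\<close>

lemma infinitely_divisible_char_fun_half:
  assumes "infinitely_divisible \<mu>" "char_fun \<mu> (2 *\<^sub>R t) = 0"
  shows "char_fun \<mu> t = 0"
proof (rule ccontr)
  assume nz: "char_fun \<mu> t \<noteq> 0"
  have le: "(norm (char_fun \<mu> t))\<^sup>2 \<le> (3/4) ^ n" if "n \<ge> 1" for n
  proof -
    obtain \<nu> where \<nu>: "is_distribution \<nu>" "convolution_power \<nu> n = \<mu>"
      using assms(1) \<open>n \<ge> 1\<close> unfolding infinitely_divisible_def by blast
    then have pow: "char_fun \<mu> s = char_fun \<nu> s ^ n" for s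
      using char_fun_convolution_power by metis
    then have "char_fun \<nu> (2 *\<^sub>R t) = 0"
      using assms(2) \<open>n \<ge> 1\<close> by simp
    \<comment> \<open>With the value 0 at 2 t the doubling inequality reads 1 \<le> 4 (1 - |.|^2),
      which is where 3/4 comes from.\<close>
    then have "(norm (char_fun \<nu> t))\<^sup>2 \<le> 3/4"
      using one_minus_norm_char_fun_double[OF \<nu>(1), of t] by simp
    then have "((norm (char_fun \<nu> t))\<^sup>2) ^ n \<le> (3/4) ^ n"
      by (rule power_mono) simp
    then show ?thesis
      by (simp add: pow norm_power flip: power_mult) (simp add: mult.commute)
  qed
  obtain n where n: "(3/4 :: real) ^ n < (norm (char_fun \<mu> t))\<^sup>2"
    using nz real_arch_pow_inv[of "(norm (char_fun \<mu> t))\<^sup>2" "3/4"] by auto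
  \<comment> \<open>The exponent found may be 0, whereas convolution roots are available only for
    positive n.\<close>
  have "(3/4 :: real) ^ Suc n \<le> (3/4) ^ n" by (rule power_decreasing) auto
  also note n
  also have "(norm (char_fun \<mu> t))\<^sup>2 \<le> (3/4) ^ Suc n" by (rule le) simp
  finally show False by simp
qed

text \<open>A zero at t would propagate to all points t / 2^n; these tend to the origin, where
  continuity forces the value 1.\<close>

lemma infinitely_divisible_char_fun_nonzero:
  assumes "infinitely_divisible \<mu>"
  shows "char_fun \<mu> t \<noteq> 0"
proof
  assume 0: "char_fun \<mu> t = 0"
  have \<mu>: "is_distribution \<mu>" using assms by (simp add: infinitely_divisible_def)
  have "char_fun \<mu> ((1/2) ^ n *\<^sub>R t) = 0" for n
  proof (induction n)
    case (Suc n)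
    show ?case
      by (rule infinitely_divisible_char_fun_half[OF assms]) (use Suc in simp)
  qed (simp add: 0)
  moreover have "(\<lambda>n. char_fun \<mu> ((1/2) ^ n *\<^sub>R t)) \<longlonglongrightarrow> char_fun \<mu> (0 *\<^sub>R t)"
    using continuous_on_char_fun[OF \<mu>, of UNIV]
    by (intro isCont_tendsto_compose[of _ "char_fun \<mu>"] tendsto_intros LIMSEQ_power_zero)
       (auto simp: continuous_on_eq_continuous_at)
  ultimately show False
    by (simp add: char_fun_0[OF \<mu>] LIMSEQ_const_iff)
qed

lemma quasi_infinitely_divisible_char_fun_nonzero:
  assumes "quasi_infinitely_divisible \<mu>"
  shows "char_fun \<mu> t \<noteq> 0"
  using assms infinitely_divisible_char_fun_nonzero unfolding quasi_infinitely_divisible_def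
  by (metis divide_eq_0_iff)

section \<open>A characteristic function with a stable zero\<close>

lemma uniform_limit_char_fun_two_units_has_zero:
  fixes u v :: "'a::euclidean_space" and f :: "nat \<Rightarrow> 'a \<Rightarrow> complex"
  assumes uv: "u \<in> Basis" "v \<in> Basis" "u \<noteq> v"
    and cont: "\<And>n. continuous_on UNIV (f n)"
    and lim: "\<And>K. compact K \<Longrightarrow>
      uniform_limit K f (\<lambda>t. (1 + iexp (t \<bullet> u) + iexp (t \<bullet> v)) / 3) sequentially"
  shows "\<exists>n t. f n t = 0"
proof -
  txt \<open>The limit function, times 3, has the explicit continuous right inverse \<open>g\<close> near its zero: a triangle
    with two unit sides whose third side is \<open>w - 1\<close>. A fixed point of \<open>w - 3 f\<^sub>n (g w)\<close> is then a zero of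
    \<open>f\<^sub>n \<circ> g\<close>.\<close>
  define \<theta> where "\<theta> w = Arg (1 - w)" for w
  \<comment> \<open>Unit vectors in the directions \<theta> - \<alpha> and \<theta> + \<alpha> add
    up to 2 cos \<alpha> times the unit vector in direction \<theta>. For the sum to be 1 - w, cos
    \<alpha> must be half of |1 - w|; the extra pi in \<open>g\<close> supplies the minus
    sign.\<close>
  define \<alpha> where "\<alpha> w = arccos (norm (1 - w) / 2)" for w :: complex
  define g where "g w = (pi + \<theta> w - \<alpha> w) *\<^sub>R u + (pi + \<theta> w + \<alpha> w) *\<^sub>R v" for w
  \<comment> \<open>Radius 1/2 keeps 1 - w off the branch cut of \<open>Arg\<close> and |1 - w| / 2
    inside the domain of \<open>arccos\<close>.\<close>
  let ?B = "cball (0 :: complex) (1/2)"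
  have norm_bounds: "1/2 \<le> norm (1 - w)" "norm (1 - w) \<le> 3/2" "Re (1 - w) > 0" if "w \<in> ?B" for w
  proof -
    have "norm w \<le> 1/2" using that by simp
    then show "1/2 \<le> norm (1 - w)" "norm (1 - w) \<le> 3/2" "Re (1 - w) > 0"
      using norm_triangle_ineq2[of 1 w] norm_triangle_ineq4[of 1 w] complex_Re_le_cmod[of w] by auto
  qed
  have g_inner: "g w \<bullet> u = pi + \<theta> w - \<alpha> w" "g w \<bullet> v = pi + \<theta> w + \<alpha> w" for w
    using uv by (simp_all add: g_def inner_add_left inner_Basis)
  have right_inverse: "1 + iexp (g w \<bullet> u) + iexp (g w \<bullet> v) = w" if "w \<in> ?B" for w
  proof -
    have "iexp (g w \<bullet> u) + iexp (g w \<bullet> v) = - (cis (\<theta> w) * (cis (\<alpha> w) + cis (- \<alpha> w)))"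
      unfolding cis_conv_exp[symmetric] g_inner
      by (simp add: complex_eq_iff cos_add sin_add cos_diff sin_diff algebra_simps)
    also have "cis (\<alpha> w) + cis (- \<alpha> w) = of_real (norm (1 - w))"
      using norm_bounds[OF that] by (simp add: complex_eq_iff \<alpha>_def)
    also have "cis (\<theta> w) * of_real (norm (1 - w)) = 1 - w"
      using rcis_cmod_Arg[of "1 - w"] by (simp add: rcis_def \<theta>_def mult.commute)
    finally show ?thesis by (simp add: add.assoc)
  qed
  have "continuous_on ?B \<theta>"
    unfolding \<theta>_def
    by (intro continuous_on_Arg' continuous_intros) (use norm_bounds(3) in \<open>fastforce simp: complex_nonpos_Reals_iff\<close>)
  moreover have "continuous_on ?B \<alpha>"
    unfolding \<alpha>_def by (intro continuous_intros) (use norm_bounds in \<open>force simp: divide_simps\<close>)+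
  ultimately have cont_g: "continuous_on ?B g"
    unfolding g_def by (intro continuous_intros)
  then have "compact (g ` ?B)"
    by (intro compact_continuous_image) auto
  \<comment> \<open>The tolerance is the radius 1/2 divided by the factor 3, so that the map below
    sends the ball into itself.\<close>
  from uniform_limitD[OF lim[OF this], of "1/6"]
  have "\<forall>\<^sub>F n in sequentially. \<forall>t\<in>g ` ?B. dist (f n t) ((1 + iexp (t \<bullet> u) + iexp (t \<bullet> v)) / 3) < 1/6"
    by simp
  then obtain n where n: "\<And>w. w \<in> ?B \<Longrightarrow> dist (f n (g w)) (w / 3) < 1/6"
    using right_inverse by (fastforce dest: eventually_happens'[OF sequentially_bot])
  have "continuous_on ?B (\<lambda>w. w - 3 * f n (g w))"
    by (intro continuous_intros continuous_on_compose2[OF cont cont_g]) auto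
  moreover have "(\<lambda>w. w - 3 * f n (g w)) \<in> ?B \<rightarrow> ?B"
  proof
    fix w assume "w \<in> ?B"
    have "norm (w - 3 * f n (g w)) = 3 * dist (f n (g w)) (w / 3)"
      using norm_mult[of 3 "f n (g w) - w / 3"]
      by (simp add: dist_norm norm_minus_commute right_diff_distrib)
    then show "w - 3 * f n (g w) \<in> ?B"
      using n[OF \<open>w \<in> ?B\<close>] by simp
  qed
  ultimately obtain w where "w - 3 * f n (g w) = w"
    by (rule brouwer[rotated 3]) auto
  then show ?thesis by auto
qed

lemma exists_char_fun_not_uniform_limit_zero_free:
  assumes "DIM('a::euclidean_space) \<noteq> 1"
  obtains \<mu> :: "'a::euclidean_space measure" where "is_distribution \<mu>"
    "\<nexists>f. (\<forall>n. continuous_on UNIV (f n) \<and> (\<forall>t. f n t \<noteq> 0)) \<and>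
       (\<forall>K. compact K \<longrightarrow> uniform_limit K f (char_fun \<mu>) sequentially)"
proof -
  have "\<not> (\<exists>u. (Basis :: 'a set) = {u})"
    using assms by (auto simp: card_1_singleton_iff)
  then obtain u v :: 'a where uv: "u \<in> Basis" "v \<in> Basis" "u \<noteq> v"
    using nonempty_Basis by blast
  then have "u \<noteq> 0" "v \<noteq> 0" by (auto simp: nonzero_Basis)
  define S where "S = {0, u, v}"
  have S: "finite S" "S \<noteq> {}" by (simp_all add: S_def)
  define \<mu> where "\<mu> = distr (measure_pmf (pmf_of_set S)) borel (\<lambda>x. x)"
  have "is_distribution \<mu>"
    unfolding \<mu>_def by (rule is_distribution_distr[OF prob_space_measure_pmf]) simp
  have char: "char_fun \<mu> = (\<lambda>t. (1 + iexp (t \<bullet> u) + iexp (t \<bullet> v)) / 3)"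
  proof
    fix t
    have "char_fun \<mu> t = (CLINT z|measure_pmf (pmf_of_set S). iexp (t \<bullet> z))"
      unfolding char_fun_def \<mu>_def by (subst integral_distr) auto
    also have "\<dots> = (\<Sum>z\<in>S. pmf (pmf_of_set S) z *\<^sub>R iexp (t \<bullet> z))"
      by (rule integral_measure_pmf) (use S in simp_all)
    also have "\<dots> = (1 + iexp (t \<bullet> u) + iexp (t \<bullet> v)) / 3"
      using uv \<open>u \<noteq> 0\<close> \<open>v \<noteq> 0\<close> by (simp add: S_def scaleR_conv_of_real field_simps)
    finally show "char_fun \<mu> t = \<dots>" .
  qed
  have "\<nexists>f. (\<forall>n. continuous_on UNIV (f n) \<and> (\<forall>t. f n t \<noteq> 0)) \<and>
       (\<forall>K. compact K \<longrightarrow> uniform_limit K f (char_fun \<mu>) sequentially)"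
    unfolding char using uniform_limit_char_fun_two_units_has_zero[OF uv] by meson
  with \<open>is_distribution \<mu>\<close> show thesis by (rule that)
qed

section \<open>Integer-valued distributions\<close>

lemma norm_integral_measure_pmf_le:
  fixes f :: "'a \<Rightarrow> 'b::{banach,second_countable_topology}"
  assumes "\<And>x. norm (f x) \<le> B"
  shows "norm (\<integral>x. f x \<partial>measure_pmf p) \<le> B"
proof -
  have "integrable (measure_pmf p) f"
    by (rule measure_pmf.integrable_const_bound[where B = B]) (use assms in auto)
  then have "(\<integral>x. norm (f x) \<partial>measure_pmf p) \<le> B"
    by (intro measure_pmf.integral_le_const) (use assms in auto)
  with integral_norm_bound[of "measure_pmf p" f] show ?thesis by linarith
qed

lemma integral_bind_pmf_bounded:
  fixes f :: "'a \<Rightarrow> complex"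
  assumes "\<And>x. norm (f x) \<le> B"
  shows "(\<integral>x. f x \<partial>measure_pmf (bind_pmf p q)) = (\<integral>y. \<integral>x. f x \<partial>measure_pmf (q y) \<partial>measure_pmf p)"
proof -
  have real: "(\<integral>x. g x \<partial>measure_pmf (bind_pmf p q)) = (\<integral>y. \<integral>x. g x \<partial>measure_pmf (q y) \<partial>measure_pmf p)"
    if "\<And>x. \<bar>g x\<bar> \<le> B" for g :: "'a \<Rightarrow> real"
    unfolding measure_pmf_bind
  proof (rule integral_bind[where K = "count_space UNIV" and B = B and B' = 1])
    show "(\<lambda>x. measure_pmf (q x)) \<in> measurable (measure_pmf p) (subprob_algebra (count_space UNIV))"
      using measurable_measure_pmf[of q] by (simp cong: measurable_cong_sets)
  qed (use that in \<open>auto simp: measure_pmf.emeasure_space_1 intro: measure_pmf.finite_measure_axioms\<close>)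
  have int: "integrable (measure_pmf r) f" for r
    by (rule measure_pmf.integrable_const_bound[where B = B]) (use assms in auto)
  have B: "norm (\<integral>x. f x \<partial>measure_pmf r) \<le> B" for r
    by (rule norm_integral_measure_pmf_le[OF assms])
  have int': "integrable (measure_pmf p) (\<lambda>y. \<integral>x. f x \<partial>measure_pmf (q y))"
    by (rule measure_pmf.integrable_const_bound[where B = B]) (use B in auto)
  show ?thesis
  proof (rule complex_eqI)
    show "Re (\<integral>x. f x \<partial>measure_pmf (bind_pmf p q)) = Re (\<integral>y. \<integral>x. f x \<partial>measure_pmf (q y) \<partial>measure_pmf p)"
      using real[of "\<lambda>x. Re (f x)"] abs_Re_le_cmod assms int int'
      by (simp add: order_trans[OF abs_Re_le_cmod assms] flip: integral_Re)
    show "Im (\<integral>x. f x \<partial>measure_pmf (bind_pmf p q)) = Im (\<integral>y. \<integral>x. f x \<partial>measure_pmf (q y) \<partial>measure_pmf p)"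
      using real[of "\<lambda>x. Im (f x)"] assms int int'
      by (simp add: order_trans[OF abs_Im_le_cmod assms] flip: integral_Im)
  qed
qed

definition pmf_char :: "int pmf \<Rightarrow> real \<Rightarrow> complex" where
  "pmf_char p \<theta> = (CLINT k|measure_pmf p. iexp (of_int k * \<theta>))"

text \<open>Divisibility is studied for integer-valued laws in the angle \<theta> = t \<bullet> v
  and carried to the space by this embedding. The offset c is arbitrary, so it can be divided by n
  when an n-th convolution root is taken.\<close>

definition lattice_measure :: "'a::euclidean_space \<Rightarrow> 'a \<Rightarrow> int pmf \<Rightarrow> 'a measure" where
  "lattice_measure v c p = distr (measure_pmf p) borel (\<lambda>k. of_int k *\<^sub>R v + c)"

lemma is_distribution_lattice_measure: "is_distribution (lattice_measure v c p)"
  unfolding lattice_measure_def by (rule is_distribution_distr[OF prob_space_measure_pmf]) simp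

lemma char_fun_lattice_measure:
  "char_fun (lattice_measure v c p) t = iexp (t \<bullet> c) * pmf_char p (t \<bullet> v)"
proof -
  have "char_fun (lattice_measure v c p) t = (CLINT k|measure_pmf p. iexp (t \<bullet> c) * iexp (of_int k * (t \<bullet> v)))"
    unfolding char_fun_def lattice_measure_def
    by (subst integral_distr) (auto simp: inner_add_right exp_add[symmetric] algebra_simps)
  then show ?thesis by (simp add: pmf_char_def)
qed

lemma pmf_char_conv_char_fun: "pmf_char p = char_fun (lattice_measure 1 0 p :: real measure)"
  by (simp add: fun_eq_iff char_fun_lattice_measure)

lemma continuous_on_pmf_char: "continuous_on A (pmf_char p)"
  unfolding pmf_char_conv_char_fun
  by (rule continuous_on_char_fun[OF is_distribution_lattice_measure])

lemma pmf_char_0 [simp]: "pmf_char p 0 = 1"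
  unfolding pmf_char_conv_char_fun by (rule char_fun_0[OF is_distribution_lattice_measure])

lemma pmf_char_return [simp]: "pmf_char (return_pmf k) \<theta> = iexp (of_int k * \<theta>)"
  by (simp add: pmf_char_def)

text \<open>Levy's uniqueness theorem for the image on the real line, whose point masses at integers
  return the pmf. Identities between convolution powers thereby reduce to identities between
  characteristic functions.\<close>

lemma pmf_char_inject:
  assumes "pmf_char p = pmf_char q"
  shows "p = q"
proof (rule pmf_eqI)
  fix k
  have rd: "real_distribution (lattice_measure 1 0 r :: real measure)" for r
    using is_distribution_lattice_measure[of "1 :: real" 0 r]
    by (auto simp: is_distribution_def real_distribution_def real_distribution_axioms_def)
  have "lattice_measure (1 :: real) 0 p = lattice_measure 1 0 q"
    using assms by (intro Levy_uniqueness rd) (simp add: pmf_char_conv_char_fun char_fun_real)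
  moreover have "measure (lattice_measure (1 :: real) 0 r) {of_int k} = pmf r k" for r
  proof -
    have "(\<lambda>k. of_int k *\<^sub>R (1 :: real) + 0) -` {of_int k} = {k}" by auto
    then show ?thesis
      unfolding lattice_measure_def by (subst measure_distr) (auto simp: measure_pmf_single)
  qed
  ultimately show "pmf p k = pmf q k" by metis
qed

section \<open>Convolution and infinite divisibility of integer-valued laws\<close>

definition conv_pmf :: "int pmf \<Rightarrow> int pmf \<Rightarrow> int pmf" where
  "conv_pmf p q = bind_pmf p (\<lambda>j. map_pmf (\<lambda>k. j + k) q)"

primrec conv_pow_pmf :: "int pmf \<Rightarrow> nat \<Rightarrow> int pmf" where
  "conv_pow_pmf p 0 = return_pmf 0"
| "conv_pow_pmf p (Suc n) = conv_pmf p (conv_pow_pmf p n)"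

lemma convolution_lattice_measure:
  fixes v c :: "'a::ordered_euclidean_space"
  shows "(lattice_measure v c p \<star> lattice_measure v c' q) = lattice_measure v (c + c') (conv_pmf p q)"
proof (rule measure_eqI)
  show "sets (lattice_measure v c p \<star> lattice_measure v c' q) = sets (lattice_measure v (c + c') (conv_pmf p q))"
    by (simp add: lattice_measure_def)
  fix A assume "A \<in> sets (lattice_measure v c p \<star> lattice_measure v c' q)"
  then have A [measurable]: "A \<in> sets borel" by simp
  have "emeasure (lattice_measure v c p \<star> lattice_measure v c' q) A =
      (\<integral>\<^sup>+x. \<integral>\<^sup>+y. indicator A (x + y) \<partial>lattice_measure v c' q \<partial>lattice_measure v c p)"
    using is_distributionD[OF is_distribution_lattice_measure[of v c p]]
      is_distributionD[OF is_distribution_lattice_measure[of v c' q]]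
    by (intro convolution_emeasure') auto
  also have "\<dots> = (\<integral>\<^sup>+j. \<integral>\<^sup>+k. indicator A (of_int j *\<^sub>R v + c + (of_int k *\<^sub>R v + c')) \<partial>measure_pmf q \<partial>measure_pmf p)"
    unfolding lattice_measure_def
    by (subst nn_integral_distr, simp_all add: nn_integral_distr)
  also have "\<dots> = (\<integral>\<^sup>+j. \<integral>\<^sup>+k. indicator A (of_int (j + k) *\<^sub>R v + (c + c')) \<partial>measure_pmf q \<partial>measure_pmf p)"
    by (simp add: algebra_simps)
  also have "\<dots> = (\<integral>\<^sup>+k. indicator A (of_int k *\<^sub>R v + (c + c')) \<partial>measure_pmf (conv_pmf p q))"
    by (simp add: conv_pmf_def)
  also have "\<dots> = (\<integral>\<^sup>+z. indicator A z \<partial>lattice_measure v (c + c') (conv_pmf p q))"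
    unfolding lattice_measure_def by (subst nn_integral_distr) simp_all
  also have "\<dots> = emeasure (lattice_measure v (c + c') (conv_pmf p q)) A"
    by (rule nn_integral_indicator) (simp add: lattice_measure_def)
  finally show "emeasure (lattice_measure v c p \<star> lattice_measure v c' q) A =
      emeasure (lattice_measure v (c + c') (conv_pmf p q)) A" .
qed

lemma convolution_power_lattice_measure:
  fixes v c :: "'a::ordered_euclidean_space"
  shows "convolution_power (lattice_measure v c p) n = lattice_measure v (of_nat n *\<^sub>R c) (conv_pow_pmf p n)"
proof (induction n)
  case 0
  show ?case
    by (simp add: lattice_measure_def return_pmf.rep_eq distr_return)
next
  case (Suc n)
  then show ?case
    by (simp add: convolution_lattice_measure scaleR_left_distrib)
qed

lemma pmf_char_conv: "pmf_char (conv_pmf p q) \<theta> = pmf_char p \<theta> * pmf_char q \<theta>"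
proof -
  have "lattice_measure (1 :: real) 0 (conv_pmf p q) = (lattice_measure 1 0 p \<star> lattice_measure 1 0 q)"
    by (simp add: convolution_lattice_measure)
  then show ?thesis
    by (simp add: pmf_char_conv_char_fun char_fun_convolution is_distribution_lattice_measure)
qed

lemma pmf_char_conv_pow: "pmf_char (conv_pow_pmf p n) \<theta> = pmf_char p \<theta> ^ n"
  by (induction n) (simp_all add: pmf_char_conv)

text \<open>The roots must be integer-valued too. This excludes the unit mass at 1, so translations
  are kept outside the pmf, as offsets or as factors \<open>iexp (m * \<theta>)\<close>.\<close>

definition inf_div_pmf :: "int pmf \<Rightarrow> bool" where
  "inf_div_pmf p \<longleftrightarrow> (\<forall>n\<ge>1. \<exists>q. conv_pow_pmf q n = p)"

lemma inf_div_pmf_return_0: "inf_div_pmf (return_pmf 0)"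
proof -
  have "conv_pow_pmf (return_pmf 0) n = return_pmf 0" for n
    by (rule pmf_char_inject) (simp add: fun_eq_iff pmf_char_conv_pow)
  then show ?thesis by (auto simp: inf_div_pmf_def)
qed

lemma inf_div_pmf_conv:
  assumes "inf_div_pmf p" "inf_div_pmf q"
  shows "inf_div_pmf (conv_pmf p q)"
  unfolding inf_div_pmf_def
proof (intro allI impI)
  fix n :: nat assume "n \<ge> 1"
  then obtain p' q' where "conv_pow_pmf p' n = p" "conv_pow_pmf q' n = q"
    using assms unfolding inf_div_pmf_def by meson
  then have "conv_pow_pmf (conv_pmf p' q') n = conv_pmf p q"
    by (intro pmf_char_inject) (auto simp: fun_eq_iff pmf_char_conv_pow pmf_char_conv power_mult_distrib)
  then show "\<exists>r. conv_pow_pmf r n = conv_pmf p q" ..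
qed

lemma infinitely_divisible_lattice_measure:
  assumes "inf_div_pmf p"
  shows "infinitely_divisible (lattice_measure v c p)"
  unfolding infinitely_divisible_def
proof (intro conjI allI impI)
  fix n :: nat assume "n \<ge> 1"
  then obtain q where "conv_pow_pmf q n = p"
    using assms unfolding inf_div_pmf_def by meson
  then have "convolution_power (lattice_measure v (c /\<^sub>R n) q) n = lattice_measure v c p"
    using \<open>n \<ge> 1\<close> by (simp add: convolution_power_lattice_measure)
  then show "\<exists>\<nu>. is_distribution \<nu> \<and> convolution_power \<nu> n = lattice_measure v c p"
    using is_distribution_lattice_measure by blast
qed (rule is_distribution_lattice_measure)

lemma inf_div_pmf_char_nonzero:
  assumes "inf_div_pmf p"
  shows "pmf_char p \<theta> \<noteq> 0"
  unfolding pmf_char_conv_char_fun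
  by (intro infinitely_divisible_char_fun_nonzero infinitely_divisible_lattice_measure assms)

section \<open>Compound Poisson distributions\<close>

definition compound_poisson_pmf :: "real \<Rightarrow> int pmf \<Rightarrow> int pmf" where
  "compound_poisson_pmf \<kappa> p = bind_pmf (poisson_pmf \<kappa>) (conv_pow_pmf p)"

lemma sums_integral_measure_pmf:
  fixes f :: "nat \<Rightarrow> complex"
  assumes "\<And>n. norm (f n) \<le> B"
  shows "(\<lambda>n. pmf p n *\<^sub>R f n) sums (\<integral>n. f n \<partial>measure_pmf p)"
proof -
  have "integrable (measure_pmf p) f"
    by (rule measure_pmf.integrable_const_bound[where B = B]) (use assms in auto)
  then have "integrable (count_space UNIV) (\<lambda>n. pmf p n *\<^sub>R f n)"
    unfolding measure_pmf_eq_density by (subst (asm) integrable_density) auto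
  then have "(\<lambda>n. pmf p n *\<^sub>R f n) sums (\<integral>n. pmf p n *\<^sub>R f n \<partial>count_space UNIV)"
    by (rule sums_integral_count_space_nat)
  also have "(\<integral>n. pmf p n *\<^sub>R f n \<partial>count_space UNIV) = (\<integral>n. f n \<partial>measure_pmf p)"
    unfolding measure_pmf_eq_density by (subst integral_density) auto
  finally show ?thesis .
qed

text \<open>The n-fold convolution contributes the n-th power, so averaging over the Poisson count
  gives the generating function of the Poisson law at \<open>pmf_char p \<theta>\<close>, an
  exponential series.\<close>

lemma pmf_char_compound_poisson:
  assumes "\<kappa> > 0"
  shows "pmf_char (compound_poisson_pmf \<kappa> p) \<theta> = exp (of_real \<kappa> * (pmf_char p \<theta> - 1))"
proof -
  define z where "z = pmf_char p \<theta>"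
  have sums: "(\<lambda>n. pmf (poisson_pmf \<kappa>) n *\<^sub>R z ^ n) sums exp (of_real \<kappa> * (z - 1))"
  proof -
    have "(\<lambda>n. exp (- of_real \<kappa>) * ((of_real \<kappa> * z) ^ n /\<^sub>R fact n)) sums (exp (- of_real \<kappa>) * exp (of_real \<kappa> * z))"
      by (intro sums_mult exp_converges)
    also have "(\<lambda>n. exp (- of_real \<kappa>) * ((of_real \<kappa> * z) ^ n /\<^sub>R fact n)) = (\<lambda>n. pmf (poisson_pmf \<kappa>) n *\<^sub>R z ^ n)"
      using assms by (simp add: fun_eq_iff scaleR_conv_of_real exp_of_real[symmetric] field_simps flip: of_real_minus)
    also have "exp (- of_real \<kappa>) * exp (of_real \<kappa> * z) = exp (of_real \<kappa> * (z - 1))"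
      by (simp add: algebra_simps flip: exp_add)
    finally show ?thesis .
  qed
  have "norm z \<le> 1"
    unfolding z_def pmf_char_def
    by (rule norm_integral_measure_pmf_le) simp
  then have "(\<lambda>n. pmf (poisson_pmf \<kappa>) n *\<^sub>R z ^ n) sums (\<integral>n. z ^ n \<partial>measure_pmf (poisson_pmf \<kappa>))"
    by (intro sums_integral_measure_pmf[where B = 1]) (simp add: norm_power power_le_one)
  then have *: "(\<integral>n. z ^ n \<partial>measure_pmf (poisson_pmf \<kappa>)) = exp (of_real \<kappa> * (z - 1))"
    using sums by (rule sums_unique2)
  have "pmf_char (compound_poisson_pmf \<kappa> p) \<theta> = (\<integral>n. pmf_char (conv_pow_pmf p n) \<theta> \<partial>measure_pmf (poisson_pmf \<kappa>))"
    unfolding compound_poisson_pmf_def pmf_char_def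
    by (rule integral_bind_pmf_bounded[where B = 1]) simp
  also have "\<dots> = exp (of_real \<kappa> * (z - 1))"
    by (simp only: pmf_char_conv_pow * flip: z_def)
  finally show ?thesis by (simp add: z_def)
qed

lemma inf_div_pmf_compound_poisson:
  assumes "\<kappa> > 0"
  shows "inf_div_pmf (compound_poisson_pmf \<kappa> p)"
  unfolding inf_div_pmf_def
proof (intro allI impI)
  fix n :: nat assume "n \<ge> 1"
  then have "conv_pow_pmf (compound_poisson_pmf (\<kappa> / n) p) n = compound_poisson_pmf \<kappa> p"
    using assms
    by (intro pmf_char_inject) (auto simp: fun_eq_iff pmf_char_conv_pow pmf_char_compound_poisson simp flip: exp_of_nat_mult)
  then show "\<exists>q. conv_pow_pmf q n = compound_poisson_pmf \<kappa> p" ..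
qed

section \<open>Trigonometric polynomials without zeros\<close>

text \<open>The \<open>b n\<close> act as Levy weights of jumps of size \<open>\<sigma> * n\<close>:
  normalised to total mass 1 they form the jump law of a compound Poisson distribution, and C
  absorbs the normalisation of the exponential.\<close>

lemma exp_suminf_eq_pmf_char:
  fixes b :: "nat \<Rightarrow> real" and \<sigma> :: int
  assumes b: "\<And>n. b n \<ge> 0" "summable b"
  obtains C p where "C > 0" "inf_div_pmf p"
    "\<And>\<theta>. exp (\<Sum>n. b n *\<^sub>R iexp (of_int \<sigma> * \<theta>) ^ n) = of_real C * pmf_char p \<theta>"
proof -
  \<comment> \<open>The extra 1 is the rate of jumps of size 0. They do not change the law, but they
    keep the rate positive even if \<open>b\<close> vanishes identically.\<close>
  define \<kappa> where "\<kappa> = suminf b + 1"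
  have "\<kappa> > 0" using suminf_nonneg[OF b(2,1)] by (simp add: \<kappa>_def)
  define w where "w n = (b n + of_bool (n = 0)) / \<kappa>" for n
  define q where "q = embed_pmf w"
  have "(\<lambda>n. of_bool (n = 0)) sums (1 :: real)"
    using sums_single[of 0 "\<lambda>_. 1 :: real"] by (simp add: of_bool_def)
  then have "w sums ((suminf b + 1) / \<kappa>)"
    unfolding w_def by (intro sums_divide sums_add summable_sums b)
  then have "w sums 1" using \<open>\<kappa> > 0\<close> by (simp add: \<kappa>_def)
  moreover have "w n \<ge> 0" for n using b(1)[of n] \<open>\<kappa> > 0\<close> by (simp add: w_def)
  ultimately have "(\<integral>\<^sup>+n. ennreal (w n) \<partial>count_space UNIV) = 1"
    by (simp add: nn_integral_count_space_nat suminf_ennreal_eq[where x = 1] sums_iff)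
  then have pmf_q: "pmf q n = w n" for n
    unfolding q_def using \<open>\<And>n. w n \<ge> 0\<close> by (simp add: pmf_embed_pmf)
  define p where "p = map_pmf (\<lambda>n. \<sigma> * int n) q"
  have "exp (\<Sum>n. b n *\<^sub>R iexp (of_int \<sigma> * \<theta>) ^ n) =
      of_real (exp (\<kappa> - 1)) * pmf_char (compound_poisson_pmf \<kappa> p) \<theta>" for \<theta>
  proof -
    define z where "z = iexp (of_int \<sigma> * \<theta>)"
    have z: "norm (z ^ n) = 1" for n by (simp add: z_def norm_power)
    have "pmf_char p \<theta> = (\<integral>n. z ^ n \<partial>measure_pmf q)"
      by (simp add: pmf_char_def p_def z_def algebra_simps flip: exp_of_nat_mult)
    then have "(\<lambda>n. w n *\<^sub>R z ^ n) sums pmf_char p \<theta>"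
      using sums_integral_measure_pmf[of "\<lambda>n. z ^ n" 1 q] z by (simp add: pmf_q)
    moreover have "(\<lambda>n. w n *\<^sub>R z ^ n) sums (((\<Sum>n. b n *\<^sub>R z ^ n) + 1) / of_real \<kappa>)"
    proof -
      have "summable (\<lambda>n. b n *\<^sub>R z ^ n)"
        by (rule summable_norm_cancel) (use b z in simp)
      moreover have "(\<lambda>n. of_bool (n = 0) *\<^sub>R z ^ n) sums 1"
      proof -
        have "(\<lambda>n. of_bool (n = 0) *\<^sub>R z ^ n) = (\<lambda>n. if n = 0 then z ^ n else 0)" by auto
        then show ?thesis using sums_single[of 0 "\<lambda>n. z ^ n"] by simp
      qed
      ultimately have "(\<lambda>n. (b n *\<^sub>R z ^ n + of_bool (n = 0) *\<^sub>R z ^ n) / of_real \<kappa>) sums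
          (((\<Sum>n. b n *\<^sub>R z ^ n) + 1) / of_real \<kappa>)"
        by (intro sums_divide sums_add summable_sums)
      then show ?thesis
        by (simp add: w_def scaleR_conv_of_real field_simps)
    qed
    ultimately have "pmf_char p \<theta> = ((\<Sum>n. b n *\<^sub>R z ^ n) + 1) / of_real \<kappa>"
      by (rule sums_unique2)
    then have *: "of_real \<kappa> * (pmf_char p \<theta> - 1) = (\<Sum>n. b n *\<^sub>R z ^ n) - of_real (\<kappa> - 1)"
      using \<open>\<kappa> > 0\<close> by (simp add: field_simps)
    show ?thesis
      unfolding pmf_char_compound_poisson[OF \<open>\<kappa> > 0\<close>] * z_def[symmetric]
      by (simp add: exp_diff flip: exp_of_real)
  qed
  with inf_div_pmf_compound_poisson[OF \<open>\<kappa> > 0\<close>] show thesis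
    by (intro that[of "exp (\<kappa> - 1)" "compound_poisson_pmf \<kappa> p"]) auto
qed

text \<open>The single factors of a polynomial need not take the value 1 at \<theta> = 0, hence the
  constant C. Requiring C > 0 later excludes the wrong sign of a square root.\<close>

definition inf_div_quotient :: "(real \<Rightarrow> complex) \<Rightarrow> bool" where
  "inf_div_quotient h \<longleftrightarrow> (\<exists>C m p q. C > 0 \<and> inf_div_pmf p \<and> inf_div_pmf q \<and>
     (\<forall>\<theta>. h \<theta> = of_real C * iexp (m * \<theta>) * (pmf_char p \<theta> / pmf_char q \<theta>)))"

lemma inf_div_quotient_mult:
  assumes "inf_div_quotient g" "inf_div_quotient h"
  shows "inf_div_quotient (\<lambda>\<theta>. g \<theta> * h \<theta>)"
proof -
  from assms(1) obtain C m p q where 1: "C > 0" "inf_div_pmf p" "inf_div_pmf q"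
    "\<And>\<theta>. g \<theta> = of_real C * iexp (m * \<theta>) * (pmf_char p \<theta> / pmf_char q \<theta>)"
    unfolding inf_div_quotient_def by blast
  from assms(2) obtain D l r s where 2: "D > 0" "inf_div_pmf r" "inf_div_pmf s"
    "\<And>\<theta>. h \<theta> = of_real D * iexp (l * \<theta>) * (pmf_char r \<theta> / pmf_char s \<theta>)"
    unfolding inf_div_quotient_def by blast
  have "g \<theta> * h \<theta> = of_real (C * D) * iexp ((m + l) * \<theta>) *
      (pmf_char (conv_pmf p r) \<theta> / pmf_char (conv_pmf q s) \<theta>)" for \<theta>
    by (simp add: 1 2 pmf_char_conv distrib_left distrib_right exp_add)
  then show ?thesis
    unfolding inf_div_quotient_def
    using 1 2 inf_div_pmf_conv by (metis mult_pos_pos)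
qed

lemma inf_div_quotient_const:
  assumes "C > 0"
  shows "inf_div_quotient (\<lambda>_. of_real C)"
  unfolding inf_div_quotient_def
  by (rule exI[of _ C], rule exI[of _ 0], intro exI[of _ "return_pmf 0"])
     (simp add: assms inf_div_pmf_return_0)

lemma inf_div_quotient_iexp: "inf_div_quotient iexp"
  unfolding inf_div_quotient_def
  by (rule exI[of _ 1], rule exI[of _ 1], intro exI[of _ "return_pmf 0"])
     (simp add: inf_div_pmf_return_0)

lemma inf_div_quotient_prod:
  assumes "\<And>i. i \<in> A \<Longrightarrow> inf_div_quotient (h i)"
  shows "inf_div_quotient (\<lambda>\<theta>. \<Prod>i\<in>A. h i \<theta>)"
  using assms
proof (induction A rule: infinite_finite_induct)
  case (insert x F)
  then show ?case by (simp add: inf_div_quotient_mult)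
qed (use inf_div_quotient_const[of 1] in simp_all)

text \<open>Pairing each root with its conjugate makes the coefficients of the logarithm real, so that their
  positive and negative parts can serve as Levy weights. The square root is taken because the product
  over all roots of a real polynomial counts each conjugate pair twice.\<close>

lemma inf_div_quotient_sqrt_conjugate_pair:
  fixes u :: complex and \<sigma> :: int
  assumes "norm u < 1"
  obtains h where "inf_div_quotient h"
    "\<And>\<theta>. (h \<theta>)\<^sup>2 = (1 - u * iexp (of_int \<sigma> * \<theta>)) * (1 - cnj u * iexp (of_int \<sigma> * \<theta>))"
proof -
  \<comment> \<open>These are the coefficients of -1/2 times ln (1 - u z) + ln (1 - cnj u z). At n =
    0 the division by zero yields 0, in agreement with the missing constant term.\<close>
  define b where "b n = Re (u ^ n) / real n" for n
  have "norm (b n) \<le> norm u ^ n" for n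
  proof (cases "n = 0")
    case False
    then have "norm (b n) \<le> \<bar>Re (u ^ n)\<bar>"
      by (simp add: b_def divide_le_eq mult_le_cancel_left1)
    then show ?thesis
      using abs_Re_le_cmod[of "u ^ n"] by (simp add: norm_power)
  qed (simp add: b_def)
  then have sb: "summable (\<lambda>n. \<bar>b n\<bar>)"
    by (intro summable_comparison_test'[OF summable_geometric[of "norm u"], of 0]) (use assms in auto)
  \<comment> \<open>Since \<open>h\<close> is the exponential of minus the series, the negative part
    supplies the numerator and the positive part the denominator.\<close>
  define bp where "bp n = max 0 (b n)" for n
  define bm where "bm n = max 0 (- b n)" for n
  have summable: "summable bp" "summable bm"
    by (rule summable_comparison_test'[OF sb, of 0], simp add: bp_def bm_def)+
  obtain C p where p: "C > 0" "inf_div_pmf p"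
    "\<And>\<theta>. exp (\<Sum>n. bm n *\<^sub>R iexp (of_int \<sigma> * \<theta>) ^ n) = of_real C * pmf_char p \<theta>"
    using exp_suminf_eq_pmf_char[of bm \<sigma>] summable by (auto simp: bm_def)
  obtain D q where q: "D > 0" "inf_div_pmf q"
    "\<And>\<theta>. exp (\<Sum>n. bp n *\<^sub>R iexp (of_int \<sigma> * \<theta>) ^ n) = of_real D * pmf_char q \<theta>"
    using exp_suminf_eq_pmf_char[of bp \<sigma>] summable by (auto simp: bp_def)
  define h where "h \<theta> = exp (- (\<Sum>n. b n *\<^sub>R iexp (of_int \<sigma> * \<theta>) ^ n))" for \<theta>
  have h_eq: "h \<theta> = of_real (C / D) * iexp (0 * \<theta>) * (pmf_char p \<theta> / pmf_char q \<theta>)" for \<theta>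
  proof -
    define z where "z = iexp (of_int \<sigma> * \<theta>)"
    have summable_z: "summable (\<lambda>n. c n *\<^sub>R z ^ n)" if "summable (\<lambda>n. \<bar>c n\<bar>)" for c :: "nat \<Rightarrow> real"
      by (rule summable_norm_cancel) (use that in \<open>simp add: z_def norm_power\<close>)
    have "\<bar>bm n\<bar> = bm n" "\<bar>bp n\<bar> = bp n" for n by (simp_all add: bm_def bp_def)
    then have "summable (\<lambda>n. bm n *\<^sub>R z ^ n)" "summable (\<lambda>n. bp n *\<^sub>R z ^ n)"
      using summable by (auto intro!: summable_z)
    then have "(\<Sum>n. bm n *\<^sub>R z ^ n) - (\<Sum>n. bp n *\<^sub>R z ^ n) = (\<Sum>n. bm n *\<^sub>R z ^ n - bp n *\<^sub>R z ^ n)"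
      by (rule suminf_diff)
    also have "\<dots> = (\<Sum>n. - (b n *\<^sub>R z ^ n))"
      by (rule suminf_cong) (auto simp: bm_def bp_def max_def)
    also have "\<dots> = - (\<Sum>n. b n *\<^sub>R z ^ n)"
      by (rule suminf_minus[OF summable_z[OF sb]])
    finally have "h \<theta> = exp (\<Sum>n. bm n *\<^sub>R z ^ n) / exp (\<Sum>n. bp n *\<^sub>R z ^ n)"
      by (simp add: h_def z_def exp_diff flip: exp_diff)
    then show ?thesis unfolding z_def p(3) q(3) by simp
  qed
  have "inf_div_quotient h"
    unfolding inf_div_quotient_def
  proof (intro exI conjI allI)
    show "C / D > 0" using p q by simp
  qed (fact p q h_eq)+
  moreover have "(h \<theta>)\<^sup>2 = (1 - u * iexp (of_int \<sigma> * \<theta>)) * (1 - cnj u * iexp (of_int \<sigma> * \<theta>))" for \<theta>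
  proof -
    define z where "z = iexp (of_int \<sigma> * \<theta>)"
    have "norm z = 1" by (simp add: z_def)
    then have small: "norm (- (u * z)) < 1" "norm (- (cnj u * z)) < 1"
      using assms by (simp_all add: norm_mult)
    have nz: "1 - u * z \<noteq> 0" "1 - cnj u * z \<noteq> 0"
      using small by (auto simp: algebra_simps)
    have "(\<lambda>n. - ((u * z) ^ n) / of_nat n + - ((cnj u * z) ^ n) / of_nat n) sums (ln (1 - u * z) + ln (1 - cnj u * z))"
      using sums_add[OF Ln_series'[OF small(1)] Ln_series'[OF small(2)]] by simp
    moreover have "- ((u * z) ^ n) / of_nat n + - ((cnj u * z) ^ n) / of_nat n = - 2 * (b n *\<^sub>R z ^ n)" for n
    proof -
      have "(u * z) ^ n + (cnj u * z) ^ n = (u ^ n + cnj (u ^ n)) * z ^ n"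
        by (simp add: power_mult_distrib algebra_simps)
      also have "\<dots> = of_real (2 * Re (u ^ n)) * z ^ n"
        by (simp only: complex_add_cnj)
      finally have *: "(u * z) ^ n + (cnj u * z) ^ n = of_real (2 * Re (u ^ n)) * z ^ n" .
      have "- ((u * z) ^ n) / of_nat n + - ((cnj u * z) ^ n) / of_nat n =
          - (((u * z) ^ n + (cnj u * z) ^ n) / of_nat n)"
        by (simp add: add_divide_distrib)
      then show ?thesis
        unfolding * by (simp add: b_def scaleR_conv_of_real)
    qed
    ultimately have "(\<lambda>n. - 2 * (b n *\<^sub>R z ^ n)) sums (ln (1 - u * z) + ln (1 - cnj u * z))"
      by simp
    moreover have "(\<lambda>n. - 2 * (b n *\<^sub>R z ^ n)) sums (- 2 * (\<Sum>n. b n *\<^sub>R z ^ n))"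
      by (intro sums_mult summable_sums summable_norm_cancel[of "\<lambda>n. b n *\<^sub>R z ^ n"])
         (use sb \<open>norm z = 1\<close> in \<open>simp add: norm_power\<close>)
    ultimately have "- 2 * (\<Sum>n. b n *\<^sub>R z ^ n) = ln (1 - u * z) + ln (1 - cnj u * z)"
      by (rule sums_unique2[symmetric])
    \<comment> \<open>Only the exponential of the sum of principal logarithms is used, so no branch
      question arises.\<close>
    then have "exp (- 2 * (\<Sum>n. b n *\<^sub>R z ^ n)) = (1 - u * z) * (1 - cnj u * z)"
      using nz by (simp add: exp_add)
    moreover have "(h \<theta>)\<^sup>2 = exp (- 2 * (\<Sum>n. b n *\<^sub>R z ^ n))"
      by (simp add: h_def z_def flip: exp_double)
    ultimately show ?thesis by (simp add: z_def)
  qed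
  ultimately show thesis by (rule that)
qed

text \<open>A root inside the circle is written z - a = z (1 - a / z), one outside as z - a = - a (1
  - z / a); in both cases the remaining factor has |u| < 1, with \<sigma> = -1 and \<sigma> = 1
  respectively. Over a conjugate pair the prefactors multiply to z^2 and |a|^2, with square roots z
  and |a|.\<close>

lemma inf_div_quotient_sqrt_root_pair:
  fixes a :: complex
  assumes "norm a \<noteq> 1"
  obtains h where "inf_div_quotient h" "\<And>\<theta>. (h \<theta>)\<^sup>2 = (iexp \<theta> - a) * (iexp \<theta> - cnj a)"
proof (cases "norm a < 1")
  case True
  obtain h where h: "inf_div_quotient h"
    "\<And>\<theta>. (h \<theta>)\<^sup>2 = (1 - a * iexp (of_int (-1) * \<theta>)) * (1 - cnj a * iexp (of_int (-1) * \<theta>))"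
    using inf_div_quotient_sqrt_conjugate_pair[OF True] by metis
  have "(iexp \<theta> * h \<theta>)\<^sup>2 = (iexp \<theta> - a) * (iexp \<theta> - cnj a)" for \<theta>
  proof -
    have "iexp \<theta> * (1 - d * iexp (of_int (-1) * \<theta>)) = iexp \<theta> - d" for d
      by (simp add: algebra_simps flip: exp_add)
    then have "(iexp \<theta> - a) * (iexp \<theta> - cnj a) =
        (iexp \<theta> * (1 - a * iexp (of_int (-1) * \<theta>))) * (iexp \<theta> * (1 - cnj a * iexp (of_int (-1) * \<theta>)))"
      by simp
    also have "\<dots> = (iexp \<theta>)\<^sup>2 *
        ((1 - a * iexp (of_int (-1) * \<theta>)) * (1 - cnj a * iexp (of_int (-1) * \<theta>)))"
      by (simp only: power2_eq_square mult_ac)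
    also have "\<dots> = (iexp \<theta> * h \<theta>)\<^sup>2"
      by (simp only: h(2) power_mult_distrib)
    finally show ?thesis ..
  qed
  then show ?thesis
    using that inf_div_quotient_mult[OF inf_div_quotient_iexp h(1)] by blast
next
  case False
  with assms have "norm a > 1" by simp
  then have "norm (inverse a) < 1" by (simp add: norm_inverse inverse_less_1_iff)
  then obtain h where h: "inf_div_quotient h"
    "\<And>\<theta>. (h \<theta>)\<^sup>2 = (1 - inverse a * iexp (of_int 1 * \<theta>)) * (1 - cnj (inverse a) * iexp (of_int 1 * \<theta>))"
    using inf_div_quotient_sqrt_conjugate_pair by metis
  have "a \<noteq> 0" using \<open>norm a > 1\<close> by auto
  have "(of_real (norm a) * h \<theta>)\<^sup>2 = (iexp \<theta> - a) * (iexp \<theta> - cnj a)" for \<theta>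
  proof -
    have "(of_real (norm a) * h \<theta>)\<^sup>2 = (a * cnj a) * (h \<theta>)\<^sup>2"
      by (simp add: power_mult_distrib complex_norm_square flip: of_real_power)
    also have "\<dots> = (a - iexp \<theta>) * (cnj a - iexp \<theta>)"
      using \<open>a \<noteq> 0\<close> by (simp add: h(2) field_simps)
    finally show ?thesis by (simp add: algebra_simps)
  qed
  moreover have "inf_div_quotient (\<lambda>\<theta>. of_real (norm a) * h \<theta>)"
    using \<open>a \<noteq> 0\<close> by (intro inf_div_quotient_mult inf_div_quotient_const h) simp
  ultimately show ?thesis by (rule that[rotated])
qed

lemma inf_div_quotient_pmf_char_poly:
  fixes P :: "complex poly"
  assumes q: "\<And>\<theta>. pmf_char q \<theta> = poly P (iexp \<theta>)"
    and real: "\<And>i. coeff P i \<in> \<real>"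
    and nz: "\<And>z. norm z = 1 \<Longrightarrow> poly P z \<noteq> 0"
  obtains m p r where "inf_div_pmf p" "inf_div_pmf r"
    "\<And>\<theta>. pmf_char q \<theta> = iexp (m * \<theta>) * (pmf_char p \<theta> / pmf_char r \<theta>)"
proof -
  obtain root where root: "smult (lead_coeff P) (\<Prod>i<degree P. [:-root i, 1:]) = P"
    using complex_poly_decompose' by blast
  have poly_P: "poly P z = lead_coeff P * (\<Prod>i<degree P. z - root i)" for z
    by (subst root[symmetric]) (simp add: poly_prod)
  have "P \<noteq> 0" using nz[of 1] by auto
  have "norm (root i) \<noteq> 1" if "i < degree P" for i
    using nz[of "root i"] that by (auto simp: poly_P)
  then have "\<forall>i\<in>{..<degree P}. \<exists>h. inf_div_quotient h \<and> (\<forall>\<theta>. (h \<theta>)\<^sup>2 = (iexp \<theta> - root i) * (iexp \<theta> - cnj (root i)))"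
    using inf_div_quotient_sqrt_root_pair by (metis lessThan_iff)
  then obtain h where h: "\<And>i. i < degree P \<Longrightarrow> inf_div_quotient (h i)"
    "\<And>i \<theta>. i < degree P \<Longrightarrow> (h i \<theta>)\<^sup>2 = (iexp \<theta> - root i) * (iexp \<theta> - cnj (root i))"
    by (metis lessThan_iff)
  define g where "g \<theta> = of_real (norm (lead_coeff P)) * (\<Prod>i<degree P. h i \<theta>)" for \<theta>
  have "inf_div_quotient g"
    unfolding g_def using \<open>P \<noteq> 0\<close>
    by (intro inf_div_quotient_mult inf_div_quotient_const inf_div_quotient_prod h(1)) auto
  then obtain C m p r where g: "C > 0" "inf_div_pmf p" "inf_div_pmf r"
    "\<And>\<theta>. g \<theta> = of_real C * iexp (m * \<theta>) * (pmf_char p \<theta> / pmf_char r \<theta>)"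
    unfolding inf_div_quotient_def by blast
  have g_nz: "g \<theta> \<noteq> 0" for \<theta>
    using g(1) inf_div_pmf_char_nonzero[OF g(2)] inf_div_pmf_char_nonzero[OF g(3)] by (simp add: g(4))
  have g2: "(g \<theta>)\<^sup>2 = (pmf_char q \<theta>)\<^sup>2" for \<theta>
  proof -
    have "(g \<theta>)\<^sup>2 = (lead_coeff P * cnj (lead_coeff P)) * (\<Prod>i<degree P. (iexp \<theta> - root i) * (iexp \<theta> - cnj (root i)))"
      unfolding g_def power_mult_distrib prod_power_distrib
      by (simp add: h(2) complex_norm_square flip: of_real_power)
    \<comment> \<open>The conjugated roots and leading coefficient form the polynomial with
      conjugated coefficients, which is P itself because P is real; so the product is a full
      square.\<close>
    also have "\<dots> = poly P (iexp \<theta>) * cnj (poly P (cnj (iexp \<theta>)))"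
      by (simp add: poly_P prod.distrib)
    also have "cnj (poly P (cnj (iexp \<theta>))) = poly P (iexp \<theta>)"
      using real by (subst poly_cnj_real) simp_all
    finally show ?thesis by (simp add: q power2_eq_square)
  qed
  have cont_g: "continuous_on UNIV g"
    unfolding g(4) by (intro continuous_intros continuous_on_pmf_char) (simp add: inf_div_pmf_char_nonzero[OF g(3)])
  \<comment> \<open>Equal squares leave only the values 1 and -1 for the quotient; continuity makes
    the choice global, and C > 0 settles it at \<theta> = 0.\<close>
  have "(\<lambda>\<theta>. pmf_char q \<theta> / g \<theta>) constant_on UNIV"
  proof (rule continuous_finite_range_constant)
    show "continuous_on UNIV (\<lambda>\<theta>. pmf_char q \<theta> / g \<theta>)"
      by (intro continuous_on_divide continuous_on_pmf_char cont_g) (simp add: g_nz)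
    have "(pmf_char q \<theta> / g \<theta>)\<^sup>2 = 1" for \<theta>
      by (simp add: power_divide g_nz flip: g2)
    then have "range (\<lambda>\<theta>. pmf_char q \<theta> / g \<theta>) \<subseteq> {1, -1}"
      unfolding power2_eq_1_iff by blast
    then show "finite (range (\<lambda>\<theta>. pmf_char q \<theta> / g \<theta>))"
      by (rule finite_subset) simp
  qed simp
  moreover have "g 0 = 1"
  proof -
    have "C\<^sup>2 = 1" using g2[of 0] by (simp add: g(4) flip: of_real_power)
    with \<open>C > 0\<close> have "C = 1" by (simp add: power2_eq_1_iff)
    then show ?thesis by (simp add: g(4))
  qed
  ultimately have "pmf_char q \<theta> / g \<theta> = 1" for \<theta>
    unfolding constant_on_def by (metis UNIV_I div_by_1 pmf_char_0)
  then have "pmf_char q \<theta> = iexp (m * \<theta>) * (pmf_char p \<theta> / pmf_char r \<theta>)" for \<theta>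
    using \<open>g 0 = 1\<close> g_nz[of \<theta>] g(4)[of 0] g(4)[of \<theta>] by (simp add: field_simps)
  with g show thesis by (intro that) auto
qed

text \<open>At \<theta> = t \<bullet> v the factor \<open>iexp (m * \<theta>)\<close> is a
  translation by m v, which joins the offset of the numerator.\<close>

lemma quasi_infinitely_divisible_lattice_measure:
  fixes P :: "complex poly" and v c :: "'a::ordered_euclidean_space"
  assumes "\<And>\<theta>. pmf_char q \<theta> = poly P (iexp \<theta>)" "\<And>i. coeff P i \<in> \<real>"
    "\<And>z. norm z = 1 \<Longrightarrow> poly P z \<noteq> 0"
  shows "quasi_infinitely_divisible (lattice_measure v c q)"
proof -
  obtain m p r where *: "inf_div_pmf p" "inf_div_pmf r"
    "\<And>\<theta>. pmf_char q \<theta> = iexp (m * \<theta>) * (pmf_char p \<theta> / pmf_char r \<theta>)"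
    using inf_div_quotient_pmf_char_poly[of q P] assms by metis
  show ?thesis
    unfolding quasi_infinitely_divisible_def
  proof (intro conjI exI allI)
    show "infinitely_divisible (lattice_measure v (c + m *\<^sub>R v) p)" "infinitely_divisible (lattice_measure v 0 r)"
      using * by (auto intro: infinitely_divisible_lattice_measure)
    fix t
    show "char_fun (lattice_measure v c q) t =
        char_fun (lattice_measure v (c + m *\<^sub>R v) p) t / char_fun (lattice_measure v 0 r) t"
      by (simp add: char_fun_lattice_measure * inner_add_right distrib_left exp_add)
  qed (rule is_distribution_lattice_measure)
qed

section \<open>Denseness in dimension one\<close>

lemma zero_free_perturbation:
  fixes w :: "nat \<Rightarrow> real"
  assumes w: "\<And>k. w k \<ge> 0" "(\<Sum>k\<le>N. w k) = 1" and "\<epsilon> > 0"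
  obtains q :: "nat pmf" and P :: "complex poly"
  where "set_pmf q \<subseteq> {..N}" "(\<Sum>k\<le>N. \<bar>pmf q k - w k\<bar>) < \<epsilon>"
    "\<And>\<theta>. pmf_char (map_pmf int q) \<theta> = poly P (iexp \<theta>)"
    "\<And>i. coeff P i \<in> \<real>" "\<And>z. norm z = 1 \<Longrightarrow> poly P z \<noteq> 0"
proof -
  txt \<open>The tilt \<open>w k \<mapsto> w k * r ^ k\<close> keeps the weights nonnegative and rescales the roots of the generating
    polynomial, so all but finitely many \<open>r\<close> move every root off the unit circle.\<close>
  define Q where "Q = (\<Sum>k\<le>N. monom (complex_of_real (w k)) k)"
  have poly_Q: "poly Q z = (\<Sum>k\<le>N. of_real (w k) * z ^ k)" for z
    by (simp add: Q_def poly_sum poly_monom)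
  have "poly Q 1 = 1" using w(2) by (simp add: poly_Q flip: of_real_sum)
  then have "Q \<noteq> 0" by auto
  define F where "F = norm ` {z. poly Q z = 0}"
  have "finite F" unfolding F_def using poly_roots_finite[OF \<open>Q \<noteq> 0\<close>] by simp
  define S where "S r = (\<Sum>k\<le>N. w k * r ^ k)" for r
  have "(S \<longlongrightarrow> (\<Sum>k\<le>N. w k * 1 ^ k)) (at 1)"
    unfolding S_def by (intro tendsto_intros)
  then have S: "(S \<longlongrightarrow> 1) (at 1)" by (simp add: w(2))
  have "((\<lambda>r. \<Sum>k\<le>N. \<bar>w k * r ^ k / S r - w k\<bar>) \<longlongrightarrow> (\<Sum>k\<le>N. \<bar>w k * 1 ^ k / 1 - w k\<bar>)) (at 1)"
    by (intro tendsto_intros S) simp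
  then have close: "((\<lambda>r. \<Sum>k\<le>N. \<bar>w k * r ^ k / S r - w k\<bar>) \<longlongrightarrow> 0) (at 1)" by simp
  \<comment> \<open>The filter \<open>at 1\<close> is punctured, so r avoids every modulus in
    \<open>F\<close> even when 1 is one of them, the very case that calls for the tilt.\<close>
  have "\<forall>\<^sub>F r in at (1 :: real). (\<Sum>k\<le>N. \<bar>w k * r ^ k / S r - w k\<bar>) < \<epsilon> \<and> S r > 0 \<and> r > 0 \<and> (\<forall>x\<in>F. r \<noteq> x)"
    by (intro eventually_conj order_tendstoD(2)[OF close] order_tendstoD(1)[OF S]
        order_tendstoD(1)[OF tendsto_ident_at] eventually_ball_finite \<open>finite F\<close> ballI
        eventually_neq_at_within) (use \<open>\<epsilon> > 0\<close> in auto)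
  then obtain r where r: "(\<Sum>k\<le>N. \<bar>w k * r ^ k / S r - w k\<bar>) < \<epsilon>" "S r > 0" "r > 0" "r \<notin> F"
    using eventually_happens'[OF at_neq_bot] by blast
  define v where "v k = (if k \<le> N then w k * r ^ k / S r else 0)" for k
  have v: "v k \<ge> 0" for k using w(1)[of k] r by (simp add: v_def)
  have "(\<Sum>k\<le>N. v k) = 1"
    using r(2) by (simp add: v_def S_def flip: sum_divide_distrib)
  then have "(\<Sum>k\<le>N. ennreal (v k)) = 1" using v by simp
  moreover have "(\<integral>\<^sup>+k. ennreal (v k) \<partial>count_space UNIV) = (\<Sum>k\<le>N. ennreal (v k))"
    by (intro nn_integral_count_space') (auto simp: v_def)
  ultimately have "(\<integral>\<^sup>+k. ennreal (v k) \<partial>count_space UNIV) = 1" by simp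
  then have pmf_q: "pmf (embed_pmf v) k = v k" for k
    using v by (intro pmf_embed_pmf) auto
  define P where "P = (\<Sum>k\<le>N. monom (complex_of_real (v k)) k)"
  have poly_P: "poly P z = (\<Sum>k\<le>N. of_real (v k) * z ^ k)" for z
    by (simp add: P_def poly_sum poly_monom)
  have supp: "set_pmf (embed_pmf v) \<subseteq> {..N}"
    by (auto simp: set_pmf_eq pmf_q v_def split: if_splits)
  show thesis
  proof
    show "set_pmf (embed_pmf v) \<subseteq> {..N}" by (rule supp)
    show "(\<Sum>k\<le>N. \<bar>pmf (embed_pmf v) k - w k\<bar>) < \<epsilon>"
      using r(1) by (simp add: pmf_q v_def)
    show "pmf_char (map_pmf int (embed_pmf v)) \<theta> = poly P (iexp \<theta>)" for \<theta>
    proof -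
      have "pmf_char (map_pmf int (embed_pmf v)) \<theta> = (CLINT k|measure_pmf (embed_pmf v). iexp \<theta> ^ k)"
        by (simp add: pmf_char_def algebra_simps flip: exp_of_nat_mult)
      also have "\<dots> = (\<Sum>k\<le>N. pmf (embed_pmf v) k *\<^sub>R iexp \<theta> ^ k)"
        using supp by (intro integral_measure_pmf) auto
      finally show ?thesis by (simp add: poly_P pmf_q scaleR_conv_of_real)
    qed
    show "coeff P i \<in> \<real>" for i
      by (auto simp: P_def coeff_sum intro!: sum_in_Reals)
    show "poly P z \<noteq> 0" if "norm z = 1" for z
    proof
      assume "poly P z = 0"
      have "poly P z = poly Q (of_real r * z) / of_real (S r)"
        by (simp add: poly_P poly_Q v_def power_mult_distrib mult.assoc sum_divide_distrib)
      with \<open>poly P z = 0\<close> r(2) have "poly Q (of_real r * z) = 0" by simp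
      moreover have "norm (of_real r * z) = r" using that r(3) by (simp add: norm_mult)
      ultimately have "r \<in> F" unfolding F_def by force
      with r(4) show False by simp
    qed
  qed
qed

text \<open>The law of the discretised variable has finitely many weights on a lattice; perturbing
  them costs at most B times their l1 distance. This is uniform in f, so a single \<nu> serves all
  test functions.\<close>

lemma quasi_infinitely_divisible_approx_lattice_valued:
  fixes \<mu> :: "'a::ordered_euclidean_space measure" and v c :: 'a and \<epsilon> :: real
  assumes \<mu>: "is_distribution \<mu>" and K [measurable]: "K \<in> borel \<rightarrow>\<^sub>M count_space UNIV"
    and K_le: "\<And>z. K z \<le> N" and "\<epsilon> > 0"
  obtains \<nu> where "quasi_infinitely_divisible \<nu>"
    "\<And>f B. \<lbrakk>f \<in> borel_measurable borel; \<And>z. \<bar>f z\<bar> \<le> B\<rbrakk> \<Longrightarrow>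
      \<bar>(LINT z|\<nu>. f z) - (LINT z|\<mu>. f (real (K z) *\<^sub>R v + c))\<bar> \<le> B * \<epsilon>"
proof -
  interpret prob_space \<mu> using \<mu> by (rule is_distributionD)
  note [measurable_cong] = is_distributionD(2)[OF \<mu>]
  define w where "w k = prob {z. K z = k}" for k
  have expectation_K: "expectation (\<lambda>z. g (K z)) = (\<Sum>k\<le>N. w k * g k)" for g :: "nat \<Rightarrow> real"
  proof -
    have meas: "{z. K z = k} \<in> events" for k
      by (simp add: is_distributionD(2)[OF \<mu>]) measurable
    have "(\<Sum>k\<le>N. indicator {z. K z = k} z * g k) = (\<Sum>k\<le>N. if K z = k then g k else 0)" for z
      by (intro sum.cong) auto
    then have "g (K z) = (\<Sum>k\<le>N. indicator {z. K z = k} z * g k)" for z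
      using K_le[of z] by simp
    then have "expectation (\<lambda>z. g (K z)) = expectation (\<lambda>z. \<Sum>k\<le>N. indicator {z. K z = k} z * g k)"
      by (simp only:)
    also have "\<dots> = (\<Sum>k\<le>N. expectation (\<lambda>z. indicator {z. K z = k} z * g k))"
      using meas by (intro Bochner_Integration.integral_sum integrable_mult_left)
        (simp add: integrable_indicator_iff less_top[symmetric])
    also have "\<dots> = (\<Sum>k\<le>N. w k * g k)"
      using is_distributionD(3)[OF \<mu>] by (simp add: w_def)
    finally show ?thesis .
  qed
  have "(\<Sum>k\<le>N. w k) = 1"
    using expectation_K[of "\<lambda>_. 1"] by (simp add: prob_space)
  then obtain q P where q: "set_pmf q \<subseteq> {..N}" "(\<Sum>k\<le>N. \<bar>pmf q k - w k\<bar>) < \<epsilon>"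
    "\<And>\<theta>. pmf_char (map_pmf int q) \<theta> = poly P (iexp \<theta>)"
    "\<And>i. coeff P i \<in> \<real>" "\<And>z. norm z = 1 \<Longrightarrow> poly P z \<noteq> 0"
    using zero_free_perturbation[of w N \<epsilon>] \<open>\<epsilon> > 0\<close> by (metis w_def measure_nonneg)
  show thesis
  proof
    show "quasi_infinitely_divisible (lattice_measure v c (map_pmf int q))"
      using q(3-5) by (rule quasi_infinitely_divisible_lattice_measure)
    fix f :: "'a \<Rightarrow> real" and B assume f [measurable]: "f \<in> borel_measurable borel" and B: "\<And>z. \<bar>f z\<bar> \<le> B"
    let ?g = "\<lambda>k. f (real k *\<^sub>R v + c)"
    have "(LINT z|lattice_measure v c (map_pmf int q). f z) = (\<integral>k. ?g k \<partial>measure_pmf q)"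
      unfolding lattice_measure_def by (subst integral_distr) auto
    also have "\<dots> = (\<Sum>k\<le>N. pmf q k * ?g k)"
      using q(1) by (subst integral_measure_pmf[of "{..N}"]) auto
    finally have "\<bar>(LINT z|lattice_measure v c (map_pmf int q). f z) - expectation (\<lambda>z. ?g (K z))\<bar>
        = \<bar>\<Sum>k\<le>N. (pmf q k - w k) * ?g k\<bar>"
      using expectation_K[of ?g] by (simp add: left_diff_distrib sum_subtractf)
    also have "\<dots> \<le> (\<Sum>k\<le>N. \<bar>pmf q k - w k\<bar> * B)"
      by (rule order_trans[OF sum_abs]) (auto simp: abs_mult intro!: sum_mono mult_left_mono B)
    also have "\<dots> = B * (\<Sum>k\<le>N. \<bar>pmf q k - w k\<bar>)"
      by (simp add: sum_distrib_left mult.commute)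
    also have "\<dots> \<le> B * \<epsilon>"
      using q(2) B[of 0] by (intro mult_left_mono) auto
    finally show "\<bar>(LINT z|lattice_measure v c (map_pmf int q). f z) - expectation (\<lambda>z. ?g (K z))\<bar> \<le> B * \<epsilon>" .
  qed
qed

text \<open>The error splits into a discretisation part, which vanishes by dominated convergence,
  and a perturbation part of at most B / (n + 1).\<close>

lemma quasi_infinitely_divisible_dense:
  fixes \<mu> :: "'a::ordered_euclidean_space measure"
  assumes dim: "DIM('a) = 1" and \<mu>: "is_distribution \<mu>"
  obtains \<nu> where "\<And>n. quasi_infinitely_divisible (\<nu> n)" "weakly_converges \<nu> \<mu>"
proof -
  obtain e :: 'a where e: "Basis = {e}"
    using dim by (auto simp: card_1_singleton_iff)
  have repr: "(z \<bullet> e) *\<^sub>R e = z" for z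
    using euclidean_representation[of z] by (simp add: e)
  \<comment> \<open>With M = n + 1 the coordinate is truncated to [-M, M] and rounded down to a
    multiple of 1/M. Adding M^2 makes the index a natural number between 0 and 2 M^2; the offset -M
    in \<open>X\<close> undoes this.\<close>
  define K where "K n z = nat \<lfloor>real (Suc n) * max (- real (Suc n)) (min (real (Suc n)) (z \<bullet> e)) + (real (Suc n))\<^sup>2\<rfloor>" for n z
  define X where "X n z = real (K n z) *\<^sub>R (e /\<^sub>R real (Suc n)) + (- real (Suc n)) *\<^sub>R e" for n z
  have meas: "K n \<in> borel \<rightarrow>\<^sub>M count_space UNIV" for n
    unfolding K_def by measurable
  have K_le: "K n z \<le> 2 * (Suc n)\<^sup>2" for n z
  proof -
    have "real (Suc n) * max (- real (Suc n)) (min (real (Suc n)) (z \<bullet> e)) \<le> real (Suc n) * real (Suc n)"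
      by (intro mult_left_mono) auto
    then have "real (Suc n) * max (- real (Suc n)) (min (real (Suc n)) (z \<bullet> e)) + (real (Suc n))\<^sup>2 \<le> of_nat (2 * (Suc n)\<^sup>2)"
      by (simp only: of_nat_mult of_nat_power of_nat_numeral power2_eq_square)
    then show ?thesis
      unfolding K_def by (simp only: nat_le_iff) linarith
  qed
  have X: "(\<lambda>n. X n z) \<longlonglongrightarrow> z" for z
  proof (rule tendstoI)
    fix \<epsilon> :: real assume "\<epsilon> > 0"
    have "\<forall>\<^sub>F n in sequentially. \<bar>z \<bullet> e\<bar> < real n"
      by (rule eventually_gt_at_top[THEN eventually_compose_filterlim]) (rule filterlim_real_sequentially)
    moreover have "\<forall>\<^sub>F n in sequentially. inverse (real (Suc n)) < \<epsilon>"
      using LIMSEQ_inverse_real_of_nat \<open>\<epsilon> > 0\<close> by (rule order_tendstoD(2))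
    ultimately show "\<forall>\<^sub>F n in sequentially. dist (X n z) z < \<epsilon>"
    proof eventually_elim
      case (elim n)
      define M where "M = real (Suc n)"
      have M: "M > 0" "\<bar>z \<bullet> e\<bar> \<le> M" using elim by (auto simp: M_def)
      define y where "y = M * (z \<bullet> e) + M\<^sup>2"
      have "y = M * ((z \<bullet> e) + M)" by (simp add: y_def power2_eq_square distrib_left)
      then have "y \<ge> 0" using M by simp
      \<comment> \<open>For large n the truncation is inactive at z, and only the rounding error of
        at most 1/M remains.\<close>
      have "max (- M) (min M (z \<bullet> e)) = z \<bullet> e" using M by linarith
      then have "K n z = nat \<lfloor>y\<rfloor>"
        unfolding K_def y_def M_def[symmetric] by (simp only:)
      then have "real (K n z) = of_int \<lfloor>y\<rfloor>" using \<open>y \<ge> 0\<close> by simp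
      then have "\<bar>real (K n z) - y\<bar> \<le> 1" by linarith
      have "X n z - z = (real (K n z) / M - M - z \<bullet> e) *\<^sub>R e"
        unfolding X_def M_def[symmetric] by (subst (2) repr[symmetric]) (simp add: algebra_simps divide_inverse)
      also have "real (K n z) / M - M - z \<bullet> e = (real (K n z) - y) / M"
        using M by (simp add: y_def field_simps power2_eq_square)
      finally have "norm (X n z - z) = \<bar>real (K n z) - y\<bar> / M"
        using M by (simp add: e)
      also have "\<dots> \<le> 1 / M"
        using \<open>\<bar>real (K n z) - y\<bar> \<le> 1\<close> M by (intro divide_right_mono) auto
      finally show ?case using elim by (simp add: dist_norm M_def inverse_eq_divide)
    qed
  qed
  have "\<exists>\<nu>. quasi_infinitely_divisible \<nu> \<and> (\<forall>f B. f \<in> borel_measurable borel \<longrightarrow> (\<forall>z. \<bar>f z\<bar> \<le> B) \<longrightarrow>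
      \<bar>(LINT z|\<nu>. f z) - (LINT z|\<mu>. f (X n z))\<bar> \<le> B * inverse (real (Suc n)))" for n
    unfolding X_def
    by (rule quasi_infinitely_divisible_approx_lattice_valued[OF \<mu> meas[of n] K_le, of "inverse (real (Suc n))"])
       (simp, blast)
  then obtain \<nu> where \<nu>: "\<And>n. quasi_infinitely_divisible (\<nu> n)"
    "\<And>n f B. \<lbrakk>f \<in> borel_measurable borel; \<And>z. \<bar>f z\<bar> \<le> B\<rbrakk> \<Longrightarrow>
      \<bar>(LINT z|\<nu> n. f z) - (LINT z|\<mu>. f (X n z))\<bar> \<le> B * inverse (real (Suc n))"
    by metis
  have "weakly_converges \<nu> \<mu>"
    unfolding weakly_converges_def
  proof (intro allI impI)
    fix f :: "'a \<Rightarrow> real" assume cont: "continuous_on UNIV f" and "bounded (range f)"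
    then obtain B where B: "\<And>z. \<bar>f z\<bar> \<le> B" by (auto simp: bounded_iff)
    have f [measurable]: "f \<in> borel_measurable borel"
      using cont by (rule borel_measurable_continuous_onI)
    note [measurable_cong] = is_distributionD(2)[OF \<mu>]
    have [measurable]: "X n \<in> borel_measurable borel" for n
      using meas[of n] unfolding X_def by measurable
    have lim: "(\<lambda>n. LINT z|\<mu>. f (X n z)) \<longlonglongrightarrow> (LINT z|\<mu>. f z)"
    proof (rule integral_dominated_convergence[where w = "\<lambda>_. B"])
      show "integrable \<mu> (\<lambda>_. B)"
        by (rule integrable_is_distribution_bounded[OF \<mu>]) auto
      show "AE z in \<mu>. (\<lambda>n. f (X n z)) \<longlonglongrightarrow> f z"
        using X cont by (intro AE_I2 isCont_tendsto_compose[of _ f]) (auto simp: continuous_on_eq_continuous_at)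
    qed (use B in auto)
    have "(\<lambda>n. B * inverse (real (Suc n))) \<longlonglongrightarrow> B * 0"
      by (intro tendsto_intros LIMSEQ_inverse_real_of_nat)
    then have null: "(\<lambda>n. B * inverse (real (Suc n))) \<longlonglongrightarrow> 0" by simp
    have "(\<lambda>n. (LINT z|\<nu> n. f z) - (LINT z|\<mu>. f (X n z))) \<longlonglongrightarrow> 0"
      by (rule Lim_null_comparison[OF _ null]) (simp only: real_norm_def \<nu>(2)[OF f B] eventually_True)
    from tendsto_add[OF this lim] show "(\<lambda>n. LINT z|\<nu> n. f z) \<longlonglongrightarrow> (LINT z|\<mu>. f z)" by simp
  qed
  with \<nu>(1) show thesis by (rule that)
qed

theorem corollary2:
  shows "((\<forall>\<mu> :: (real ^ 'd) measure. is_distribution \<mu> \<longrightarrow>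
            (\<exists>\<nu>. (\<forall>n. quasi_infinitely_divisible (\<nu> n)) \<and> weakly_converges \<nu> \<mu>))
          \<longleftrightarrow> CARD('d) = 1)
       \<and> ((\<forall>\<mu> :: (real ^ 'd) measure. is_distribution \<mu> \<longrightarrow>
            (\<exists>f :: nat \<Rightarrow> real ^ 'd \<Rightarrow> complex.
               (\<forall>n. continuous_on UNIV (f n) \<and> (\<forall>t. f n t \<noteq> 0)) \<and>
               (\<forall>K. compact K \<longrightarrow> uniform_limit K f (char_fun \<mu>) sequentially)))
          \<longleftrightarrow> CARD('d) = 1)"
    (is "((\<forall>\<mu>. _ \<mu> \<longrightarrow> ?qid_limit \<mu>) \<longleftrightarrow> _) \<and> ((\<forall>\<mu>. _ \<mu> \<longrightarrow> ?zero_free_limit \<mu>) \<longleftrightarrow> _)")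
proof -
  have dense: "?qid_limit \<mu>" if "CARD('d) = 1" "is_distribution \<mu>" for \<mu> :: "(real ^ 'd) measure"
    using quasi_infinitely_divisible_dense[of \<mu>] that by (metis DIM_cart DIM_real mult_1_right)
  have zero_free: "?zero_free_limit \<mu>" if "?qid_limit \<mu>" "is_distribution \<mu>" for \<mu> :: "(real ^ 'd) measure"
  proof -
    from that(1) obtain \<nu> where \<nu>: "\<And>n. quasi_infinitely_divisible (\<nu> n)" "weakly_converges \<nu> \<mu>"
      by blast
    then have dist: "is_distribution (\<nu> n)" for n
      by (simp add: quasi_infinitely_divisible_def)
    show ?thesis
    proof (intro exI[of _ "\<lambda>n. char_fun (\<nu> n)"] conjI allI impI)
      show "char_fun (\<nu> n) t \<noteq> 0" for n t
        by (rule quasi_infinitely_divisible_char_fun_nonzero[OF \<nu>(1)])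
      show "continuous_on UNIV (char_fun (\<nu> n))" for n
        by (rule continuous_on_char_fun[OF dist])
      show "uniform_limit K (\<lambda>n. char_fun (\<nu> n)) (char_fun \<mu>) sequentially" if "compact K" for K
        using dist \<open>is_distribution \<mu>\<close> \<nu>(2) that
        by (rule weakly_converges_imp_uniform_limit_char_fun)
    qed
  qed
  have card: "CARD('d) = 1" if "\<forall>\<mu> :: (real ^ 'd) measure. is_distribution \<mu> \<longrightarrow> ?zero_free_limit \<mu>"
  proof (rule ccontr)
    assume "CARD('d) \<noteq> 1"
    then have "DIM(real ^ 'd) \<noteq> 1" by simp
    then show False
      using exists_char_fun_not_uniform_limit_zero_free that by blast
  qed
  \<comment> \<open>The implications form a cycle: d = 1, denseness, zero-free approximation, d =
    1.\<close>
  show ?thesis using dense zero_free card by blast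
qed

end
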